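(* Let $q\in\mathbb Z^n\setminus\{0\}$ with $\langle\omega,q\rangle>0$. Suppose $\widehat N^{q},\widehat N^{-q},\widehat N^0\in\mathcal N\cap\mathcal A$, $\mathbf z^{\mathbf k_{\pm q}}\widehat N^{\pm q}=O_3(\mathbf z)$, and $\widehat N^0=O_2(\kappa)$. Then there exists $\widehat\rho>0$ such that the system $$\partial_\delta N^{\pm q}=-N^{\pm q}\,\langle q,\partial\rangle N^0,\qquad \partial_\delta N^0=-2\,\langle q,\partial\rangle\big(\kappa^{[q]}N^{-q}N^q\big)\,e^{-2\omega_q\delta}$$ with initial conditions $N^{\pm q}|_{\delta=0}=\widehat N^{\pm q}$, $N^0|_{\delta=0}=\widehat N^0$ has a solution $N^{\pm q},N^0\in\mathcal A^{\widehat\rho}$ for all $\delta>0$. Moreover, $$\lim_{\delta\to+\infty}e^{-\omega_q\delta}N^{\pm q}=0,\qquad \lim_{\delta\to+\infty}N^0\in\mathcal N\cap\mathcal A^{\widehat\rho},$$ where the limits are taken with respect to the norm $\|\cdot\|_{\widehat\rho}$.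
   Context: Let $n\ge1$ and let $\omega\in\mathbb R^n$ be nonresonant: $\langle p,\omega\rangle\ne0$ for all $p\in\mathbb Z^n\setminus\{0\}$. Put $\omega_q=|\langle\omega,q\rangle|$. Let $z=(z_1,\dots,z_n)$, $\overline z=(\overline z_1,\dots,\overline z_n)$ be independent complex variables (the bar is not complex conjugation), $\mathbf z=(z,\overline z)$, and for $\mathbf k=(k,\overline k)\in\mathbb Z_+^{2n}$ put $\mathbf z^{\mathbf k}=z^k\overline z^{\overline k}$. Put $\kappa_j=z_j\overline z_j$, $\kappa=(\kappa_1,\dots,\kappa_n)$, $\partial=(\partial_{\kappa_1},\dots,\partial_{\kappa_n})$, $[q]=(|q_1|,\dots,|q_n|)$, so $\langle q,\partial\rangle=\sum_jq_j\partial_{\kappa_j}$ and $\kappa^{[q]}=\prod_j\kappa_j^{|q_j|}$. For $q\in\mathbb Z^n$, $\mathbf k_q=(k_q,\overline k_q)\in\mathbb Z_+^{2n}$ is the unique element with $\overline k_q-k_q=q$ and $\min\{(k_q)_j,(\overline k_q)_j\}=0$ for all $j$. $\mathcal N$ is the space of formal power series in $z,\overline z$ which depend on $z,\overline z$ only through $\kappa_1,\dots,\kappa_n$; the operators $\partial_{\kappa_j}$ act on $\mathcal N$. For $\rho>0$ let $D_\rho=\{\mathbf z\in\mathbb C^{2n}:|z_j|<\rho,\ |\overline z_j|<\rho,\ j=1,\dots,n\}$; $\mathcal A^\rho$ is the Banach space of power series in $\mathbf z$ converging to an analytic function on $D_\rho$ with finite norm $\|H\|_\rho=\sup_{D_\rho}|H|$,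 and $\mathcal A=\bigcup_{\rho>0}\mathcal A^\rho$. $O_m(\mathbf z)$ (resp. $O_m(\kappa)$) denotes a power series all of whose terms have degree at least $m$ in $\mathbf z$ (resp. in $\kappa$). *)

theory Defs
  imports "HOL-Analysis.Analysis"
begin

text \<open>
  A pair of multi-indices \<open>(k, kb)\<close> stands for the exponent of the monomial
  \<open>z^k zb^kb\<close>, where \<open>z\<close> and \<open>zb\<close> are independent variables: \<open>zb\<close> is not
  the conjugate of \<open>z\<close>. A formal power series is its family of coefficients.
\<close>

type_synonym 'n exponent = "(nat^'n) \<times> (nat^'n)"
type_synonym 'n series = "'n exponent \<Rightarrow> complex"

definition pairing :: "real^'n \<Rightarrow> int^'n \<Rightarrow> real" where
  "pairing \<omega> q = (\<Sum>j\<in>UNIV. \<omega> $ j * of_int (q $ j))"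

definition nonresonant :: "real^'n \<Rightarrow> bool" where
  "nonresonant \<omega> \<longleftrightarrow> (\<forall>p. p \<noteq> 0 \<longrightarrow> pairing \<omega> p \<noteq> 0)"

definition freq :: "real^'n \<Rightarrow> int^'n \<Rightarrow> real" where
  "freq \<omega> q = \<bar>pairing \<omega> q\<bar>"

subsection \<open>Formal power series\<close>

definition monom_series :: "'n exponent \<Rightarrow> 'n::finite series" where
  "monom_series m = (\<lambda>k. if k = m then 1 else 0)"

definition series_mult :: "'n series \<Rightarrow> 'n series \<Rightarrow> 'n::finite series"
    (infixl \<open>\<star>\<close> 70) where
  "F \<star> G = (\<lambda>k. \<Sum>(i, j) \<in> {(i, j). i + j = k}. F i * G j)"

text \<open>The sum in the Cauchy product is finite, so it never takes the default value 0.\<close>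

lemma finite_exponent_splittings:
  fixes k :: "'n::finite exponent"
  shows "finite {(i, j). i + j = k}"
proof -
  have fin: "finite {v :: nat^'n. \<forall>l. v $ l \<le> w $ l}" for w
  proof -
    have "finite ((UNIV :: 'n set) \<rightarrow>\<^sub>E {.. Max (range (($) w))})"
      by (intro finite_PiE) auto
    moreover have "vec_nth ` {v :: nat^'n. \<forall>l. v $ l \<le> w $ l}
        \<subseteq> UNIV \<rightarrow>\<^sub>E {.. Max (range (($) w))}"
    proof -
      have "w $ l \<le> Max (range (($) w))" for l
        by (rule Max_ge) auto
      then show ?thesis
        by (auto intro: order_trans)
    qed
    ultimately have "finite (vec_nth ` {v :: nat^'n. \<forall>l. v $ l \<le> w $ l})"
      by (rule rev_finite_subset)
    then show ?thesis
      by (rule finite_imageD) (auto simp: inj_on_def vec_eq_iff)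
  qed
  let ?B = "{v :: nat^'n. \<forall>l. v $ l \<le> fst k $ l} \<times> {v :: nat^'n. \<forall>l. v $ l \<le> snd k $ l}"
  have "{(i, j). i + j = k} \<subseteq> ?B \<times> ?B"
    by auto
  then show ?thesis
    by (rule finite_subset) (intro finite_cartesian_product fin)
qed

definition is_O_z :: "nat \<Rightarrow> 'n::finite series \<Rightarrow> bool" where
  "is_O_z m H \<longleftrightarrow>
     (\<forall>k kb. (\<Sum>j\<in>UNIV. k $ j) + (\<Sum>j\<in>UNIV. kb $ j) < m \<longrightarrow> H (k, kb) = 0)"

text \<open>\<open>in_kappa f\<close> is the series \<open>\<Sum>k. f k \<kappa>^k\<close> with \<open>\<kappa>_j = z_j zb_j\<close>.\<close>

definition in_kappa :: "(nat^'n \<Rightarrow> complex) \<Rightarrow> 'n::finite series" where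
  "in_kappa f = (\<lambda>(k, kb). if k = kb then f k else 0)"

definition kappa_space :: "'n::finite series set" where
  "kappa_space = range in_kappa"

definition is_O_kappa :: "nat \<Rightarrow> 'n::finite series \<Rightarrow> bool" where
  "is_O_kappa m H \<longleftrightarrow>
     (\<exists>f. H = in_kappa f \<and> (\<forall>k. (\<Sum>j\<in>UNIV. k $ j) < m \<longrightarrow> f k = 0))"

text \<open>
  The derivative with respect to \<open>\<kappa>_j\<close>, meaningful only on \<^const>\<open>kappa_space\<close>: the
  coefficient of \<open>\<kappa>^k\<close> in \<open>H\<close> is \<open>H (k, k)\<close>.
\<close>

definition deriv_kappa :: "'n \<Rightarrow> 'n series \<Rightarrow> 'n::finite series" where
  "deriv_kappa j H =
     in_kappa (\<lambda>k. of_nat (k $ j + 1) * H (k + axis j 1, k + axis j 1))"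

definition dir_deriv_kappa :: "int^'n \<Rightarrow> 'n series \<Rightarrow> 'n::finite series" where
  "dir_deriv_kappa q H = (\<lambda>k. \<Sum>j\<in>UNIV. of_int (q $ j) * deriv_kappa j H k)"

definition kappa_abs :: "int^'n \<Rightarrow> 'n::finite series" where
  "kappa_abs q = monom_series (\<chi> j. nat \<bar>q $ j\<bar>, \<chi> j. nat \<bar>q $ j\<bar>)"

definition min_exponent :: "int^'n \<Rightarrow> 'n::finite exponent" where
  "min_exponent q =
     (THE (k, kb). \<forall>j. int (kb $ j) - int (k $ j) = q $ j \<and> min (k $ j) (kb $ j) = 0)"

lemma min_exponent_eq: "min_exponent q = (\<chi> j. nat (- q $ j), \<chi> j. nat (q $ j))"
  unfolding min_exponent_def
proof (rule the_equality)
  show "case (\<chi> j. nat (- q $ j), \<chi> j. nat (q $ j)) of (k, kb) \<Rightarrow>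
      \<forall>j. int (kb $ j) - int (k $ j) = q $ j \<and> min (k $ j) (kb $ j) = 0"
    by auto
next
  fix x :: "'a exponent"
  assume x: "case x of (k, kb) \<Rightarrow>
      \<forall>j. int (kb $ j) - int (k $ j) = q $ j \<and> min (k $ j) (kb $ j) = 0"
  obtain k kb where k: "x = (k, kb)" by (cases x)
  have "k $ j = nat (- q $ j) \<and> kb $ j = nat (q $ j)" for j
  proof -
    have "int (kb $ j) - int (k $ j) = q $ j" "min (k $ j) (kb $ j) = 0"
      using x k by auto
    then show ?thesis by (auto simp: min_def split: if_splits)
  qed
  then show "x = (\<chi> j. nat (- q $ j), \<chi> j. nat (q $ j))"
    by (simp add: k vec_eq_iff)
qed

subsection \<open>Convergent power series on polydiscs\<close>

definition polydisc :: "real \<Rightarrow> ((complex^'n) \<times> (complex^'n)) set" where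
  "polydisc \<rho> = {(z, zb). \<forall>j. cmod (z $ j) < \<rho> \<and> cmod (zb $ j) < \<rho>}"

definition monom_val :: "(complex^'n) \<times> (complex^'n) \<Rightarrow> 'n::finite exponent \<Rightarrow> complex" where
  "monom_val = (\<lambda>(z, zb) (k, kb). (\<Prod>j\<in>UNIV. z $ j ^ (k $ j)) * (\<Prod>j\<in>UNIV. zb $ j ^ (kb $ j)))"

definition series_eval :: "'n series \<Rightarrow> (complex^'n) \<times> (complex^'n::finite) \<Rightarrow> complex" where
  "series_eval H x = (\<Sum>\<^sub>\<infinity>k. H k * monom_val x k)"

text \<open>
  The sum of a power series that converges at every point of a polydisc is analytic there.
  Outside \<^term>\<open>analytic_space \<rho>\<close> the value of \<open>series_norm \<rho>\<close> is meaningless.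
\<close>

definition analytic_space :: "real \<Rightarrow> 'n::finite series set" where
  "analytic_space \<rho> =
     {H. (\<forall>x\<in>polydisc \<rho>. (\<lambda>k. H k * monom_val x k) summable_on UNIV) \<and>
         bdd_above ((\<lambda>x. cmod (series_eval H x)) ` polydisc \<rho>)}"

definition series_norm :: "real \<Rightarrow> 'n::finite series \<Rightarrow> real" where
  "series_norm \<rho> H = (SUP x\<in>polydisc \<rho>. cmod (series_eval H x))"

definition analytic_germs :: "'n::finite series set" where
  "analytic_germs = (\<Union>\<rho>\<in>{0<..}. analytic_space \<rho>)"

definition norm_limit ::
    "real \<Rightarrow> ('a \<Rightarrow> 'n::finite series) \<Rightarrow> 'n series \<Rightarrow> 'a filter \<Rightarrow> bool" where
  "norm_limit \<rho> F L S \<longleftrightarrow>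
     (\<forall>\<^sub>F t in S. F t \<in> analytic_space \<rho>) \<and> L \<in> analytic_space \<rho> \<and>
     ((\<lambda>t. series_norm \<rho> (\<lambda>k. F t k - L k)) \<longlongrightarrow> 0) S"

text \<open>
  Derivative of a curve on the half-line \<open>{0..}\<close> in the Banach space \<^term>\<open>analytic_space \<rho>\<close>;
  one-sided at 0.
\<close>

definition has_norm_deriv ::
    "real \<Rightarrow> (real \<Rightarrow> 'n::finite series) \<Rightarrow> 'n series \<Rightarrow> real \<Rightarrow> bool" where
  "has_norm_deriv \<rho> F F' \<delta> \<longleftrightarrow>
     norm_limit \<rho> (\<lambda>t k. (F t k - F \<delta> k) / of_real (t - \<delta>)) F' (at \<delta> within {0..})"

end

theory Submission
  imports Defs
begin

text \<open>
  Write \<open>P\<close>, \<open>R\<close> for the initial values of \<open>N^q\<close>, \<open>N^-q\<close> and \<open>D = \<langle>q,\<partial>\<rangle>\<close>, \<open>w = \<omega>_q\<close>. Both \<open>N^q\<close> and \<open>N^-q\<close>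
  solve the same linear equation, so they are \<open>P E\<close> and \<open>R E\<close> with \<open>E' = - E D N0\<close>, \<open>E(0) = 1\<close>, and
  \<open>N0' = - 2 exp(- 2 w \<delta>) D(G E E)\<close>, where \<open>G = \<kappa>^[q] P R = O_3(\<kappa>)\<close>.
  Ordered by degree in \<open>\<kappa>\<close>, this system is triangular, so
  Picard iterates become stationary coefficient by coefficient. The loss of one \<open>\<kappa>\<close>-derivative
  is compensated by measuring the coefficients at time \<open>\<delta>\<close> with a radius \<open>s(\<delta>)\<close> which shrinks at
  the rate \<open>exp(- w \<delta> / 4)\<close>, hence never below \<open>s(0) / 2\<close>. If \<open>s(0)\<close> is small, then \<open>D N0\<close> is small
  compared with \<open>w\<close>, and a ball of majorants growing like \<open>exp(w \<delta> / 2)\<close> is invariant under the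
  Picard map. Finally, coefficientwise limits and derivatives with uniform geometric bounds are limits and
  derivatives in the norm of a smaller polydisc.
\<close>

subsection \<open>Coefficient sequences in \<open>\<kappa>\<close> and their convolution\<close>

definition tdeg :: "nat^'n::finite \<Rightarrow> nat" where
  "tdeg k = (\<Sum>j\<in>UNIV. k $ j)"

definition cauchy :: "(nat^'n \<Rightarrow> complex) \<Rightarrow> (nat^'n \<Rightarrow> complex) \<Rightarrow> nat^'n::finite \<Rightarrow> complex" where
  "cauchy f g k = (\<Sum>(i, j) \<in> {(i, j). i + j = k}. f i * g j)"

definition dir_deriv :: "int^'n \<Rightarrow> (nat^'n \<Rightarrow> complex) \<Rightarrow> nat^'n::finite \<Rightarrow> complex" where
  "dir_deriv q f k = (\<Sum>j\<in>UNIV. of_int (q $ j) * (of_nat (k $ j + 1) * f (k + axis j 1)))"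

lemma tdeg_add [simp]: "tdeg (i + j) = tdeg i + tdeg j"
  by (simp add: tdeg_def sum.distrib)

lemma tdeg_0 [simp]: "tdeg 0 = 0"
  by (simp add: tdeg_def)

lemma tdeg_axis [simp]: "tdeg (axis j a) = a"
  by (simp add: tdeg_def axis_def)

lemma component_le_tdeg: "k $ j \<le> tdeg k"
  unfolding tdeg_def by (rule member_le_sum) auto

lemma bij_betw_vec_lambda_box:
  fixes m :: "nat^'n::finite"
  shows "bij_betw vec_lambda (Pi\<^sub>E UNIV (\<lambda>l. {..m $ l})) {k. \<forall>l. k $ l \<le> m $ l}"
proof (rule bij_betwI[where g = vec_nth])
  show "vec_lambda \<in> Pi\<^sub>E UNIV (\<lambda>l. {..m $ l}) \<rightarrow> {k. \<forall>l. k $ l \<le> m $ l}"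
    by (auto simp: PiE_iff)
qed (auto simp: vec_lambda_inverse)

lemma finite_box: "finite {k :: nat^'n::finite. \<forall>l. k $ l \<le> m $ l}"
  using bij_betw_finite[OF bij_betw_vec_lambda_box[of m]] by (auto intro!: finite_PiE)

text \<open>Distributivity; it reduces sums over exponents to sums in one variable at a
  time.\<close>

lemma sum_box_prod:
  fixes m :: "nat^'n::finite" and h :: "'n \<Rightarrow> nat \<Rightarrow> real"
  shows "(\<Sum>k | \<forall>l. k $ l \<le> m $ l. \<Prod>l\<in>UNIV. h l (k $ l)) = (\<Prod>l\<in>UNIV. \<Sum>a\<le>m $ l. h l a)"
proof -
  have "(\<Prod>l\<in>UNIV. \<Sum>a\<le>m $ l. h l a) = (\<Sum>g\<in>Pi\<^sub>E UNIV (\<lambda>l. {..m $ l}). \<Prod>l\<in>UNIV. h l (g l))"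
    by (rule prod_sum_PiE) auto
  also have "\<dots> = (\<Sum>k | \<forall>l. k $ l \<le> m $ l. \<Prod>l\<in>UNIV. h l (k $ l))"
    using sum.reindex_bij_betw[OF bij_betw_vec_lambda_box[of m], of "\<lambda>k. \<Prod>l\<in>UNIV. h l (k $ l)"]
    by simp
  finally show ?thesis by simp
qed

lemma bij_betw_splittings:
  fixes k :: "nat^'n::finite"
  shows "bij_betw (\<lambda>i. (i, k - i)) {i. \<forall>l. i $ l \<le> k $ l} {(i, j). i + j = k}"
proof (rule bij_betw_imageI)
  show "(\<lambda>i. (i, k - i)) ` {i. \<forall>l. i $ l \<le> k $ l} = {(i, j). i + j = k}"
  proof (intro equalityI subsetI)
    fix x assume "x \<in> {(i, j). i + j = k}"
    then obtain i j where x: "x = (i, j)" and k: "k = i + j" by auto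
    have "x = (i, k - i)" by (simp add: x k)
    then show "x \<in> (\<lambda>i. (i, k - i)) ` {i. \<forall>l. i $ l \<le> k $ l}" by (auto simp: k)
  qed (auto simp: vec_eq_iff)
qed (auto simp: inj_on_def)

lemma finite_splittings: "finite {(i, j). i + j = (k :: nat^'n::finite)}"
  using bij_betw_finite[OF bij_betw_splittings[of k]] finite_box by auto

lemma sum_splittings_swap:
  fixes k :: "nat^'n::finite"
  shows "(\<Sum>(i, j) \<in> {(i, j). i + j = k}. h i j) = (\<Sum>(i, j) \<in> {(i, j). i + j = k}. h j i)"
  by (rule sum.reindex_bij_witness[where i = prod.swap and j = prod.swap]) (auto simp: add.commute)

lemma cauchy_commute: "cauchy f g = cauchy g f"
proof
  fix k show "cauchy f g k = cauchy g f k"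
    unfolding cauchy_def using sum_splittings_swap[of "\<lambda>i j. f i * g j" k] by (simp add: mult.commute)
qed

lemma cauchy_assoc:
  fixes f g h :: "nat^'n::finite \<Rightarrow> complex"
  shows "cauchy (cauchy f g) h = cauchy f (cauchy g h)"
proof
  fix k :: "nat^'n"
  let ?S = "\<lambda>k :: nat^'n. {(i, j). i + j = k}"
  have "cauchy (cauchy f g) h k = (\<Sum>x\<in>?S k. \<Sum>y\<in>?S (fst x). f (fst y) * g (snd y) * h (snd x))"
    by (simp add: cauchy_def case_prod_unfold sum_distrib_right)
  also have "\<dots> = (\<Sum>(x, y)\<in>Sigma (?S k) (\<lambda>x. ?S (fst x)). f (fst y) * g (snd y) * h (snd x))"
    by (rule sum.Sigma) (simp_all add: finite_splittings)
  also have "\<dots> = (\<Sum>(x, y)\<in>Sigma (?S k) (\<lambda>x. ?S (snd x)). f (fst x) * (g (fst y) * h (snd y)))"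
    by (rule sum.reindex_bij_witness[where
          i = "\<lambda>((a, _), (b, c)). ((a + b, c), (a, b))" and j = "\<lambda>((_, c), (a, b)). ((a, b + c), (b, c))"])
      (auto simp: algebra_simps)
  also have "\<dots> = (\<Sum>x\<in>?S k. \<Sum>y\<in>?S (snd x). f (fst x) * (g (fst y) * h (snd y)))"
    by (rule sum.Sigma[symmetric]) (simp_all add: finite_splittings)
  also have "\<dots> = cauchy f (cauchy g h) k"
    by (simp add: cauchy_def case_prod_unfold sum_distrib_left)
  finally show "cauchy (cauchy f g) h k = cauchy f (cauchy g h) k" .
qed

definition unit_coeff :: "nat^'n::finite \<Rightarrow> complex" where
  "unit_coeff k = (if k = 0 then 1 else 0)"

lemma cauchy_unit:
  fixes f :: "nat^'n::finite \<Rightarrow> complex"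
  shows "cauchy f unit_coeff = f"
proof
  fix k :: "nat^'n"
  have "cauchy f unit_coeff k = (\<Sum>(i, j) \<in> {(k, 0 :: nat^'n)}. f i * unit_coeff j)"
    unfolding cauchy_def
    by (rule sum.mono_neutral_cong_right) (auto simp: finite_splittings unit_coeff_def split: if_splits)
  then show "cauchy f unit_coeff k = f k" by (simp add: unit_coeff_def)
qed

lemma norm_cauchy_le:
  "cmod (cauchy f g k) \<le> (\<Sum>(i, j) \<in> {(i, j). i + j = k}. cmod (f i) * cmod (g j))"
  unfolding cauchy_def by (rule order_trans[OF norm_sum]) (simp add: case_prod_unfold norm_mult)

lemma cauchy_low_degree:
  assumes "\<And>k. tdeg k < m \<Longrightarrow> f k = 0" and "\<And>k. tdeg k < n \<Longrightarrow> g k = 0" and "tdeg k < m + n"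
  shows "cauchy f g k = 0"
  unfolding cauchy_def
proof (rule sum.neutral, clarify)
  fix i j assume "k = i + j"
  then have "tdeg i < m \<or> tdeg j < n" using assms(3) by auto
  then show "f i * g j = 0" using assms(1,2) by auto
qed

section \<open>Weights that convolution reproduces up to a constant factor\<close>

definition wt :: "nat^'n::finite \<Rightarrow> real" where
  "wt k = (\<Prod>j\<in>UNIV. 1 / (real (k $ j) + 1)\<^sup>2)"

text \<open>One inverse power of the degree is kept in reserve: a derivative in \<kappa> uses it up
  and leaves \<open>wt\<close>.\<close>

definition wt1 :: "nat^'n::finite \<Rightarrow> real" where
  "wt1 k = wt k / (real (tdeg k) + 1)"

lemma wt_pos: "wt k > 0"
  by (auto simp: wt_def intro!: prod_pos)

lemma wt1_pos: "wt1 k > 0"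
  by (simp add: wt1_def wt_pos)

lemma wt_le_1: "wt k \<le> 1"
  unfolding wt_def by (rule prod_le_1) auto

lemma wt1_le_wt: "wt1 k \<le> wt k"
  using wt_pos[of k] by (simp add: wt1_def field_simps)

lemma wt_eq: "wt k = (real (tdeg k) + 1) * wt1 k"
  by (simp add: wt1_def field_simps)

lemma wt_0 [simp]: "wt 0 = 1" and wt1_0 [simp]: "wt1 0 = 1"
  by (simp_all add: wt_def wt1_def)

lemma wt_add_le: "wt (k + l) \<le> wt k"
  unfolding wt_def by (rule prod_mono) (auto intro!: divide_left_mono power_mono)

text \<open>From \<open>m + 1 \<le> 2 ^ m\<close> the squares cost at most \<open>4 ^ tdeg k\<close>
  and the degree factor at most \<open>2 ^ tdeg k\<close>. So a geometric bound without weight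
  becomes a weighted one at an eighth of the radius.\<close>

lemma wt1_lower: "1 \<le> 8 ^ tdeg k * wt1 k"
proof -
  have le: "real m + 1 \<le> 2 ^ m" for m :: nat
    using less_exp[of m] by (simp add: nat_less_real_le)
  have "(\<Prod>j\<in>UNIV. (real (k $ j) + 1)\<^sup>2) \<le> (\<Prod>j\<in>UNIV. (4::real) ^ (k $ j))"
  proof (rule prod_mono, safe)
    fix j show "(real (k $ j) + 1)\<^sup>2 \<le> 4 ^ (k $ j)"
      using power_mono[OF le, of "k $ j" 2] by (simp add: power2_eq_square[of "2 ^ _"] flip: power_mult_distrib)
  qed auto
  also have "\<dots> = 4 ^ tdeg k" by (simp add: tdeg_def power_sum)
  finally have "(real (tdeg k) + 1) * (\<Prod>j\<in>UNIV. (real (k $ j) + 1)\<^sup>2) \<le> 2 ^ tdeg k * 4 ^ tdeg k"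
    by (intro mult_mono le) (auto intro!: prod_nonneg)
  also have "\<dots> = 8 ^ tdeg k" by (simp flip: power_mult_distrib)
  finally have "(real (tdeg k) + 1) * (\<Prod>j\<in>UNIV. (real (k $ j) + 1)\<^sup>2) \<le> 8 ^ tdeg k" .
  moreover have "wt1 k = 1 / ((real (tdeg k) + 1) * (\<Prod>j\<in>UNIV. (real (k $ j) + 1)\<^sup>2))"
    by (simp add: wt1_def wt_def prod_dividef)
  moreover have "(real (tdeg k) + 1) * (\<Prod>j\<in>UNIV. (real (k $ j) + 1)\<^sup>2) > 0"
    by (intro mult_pos_pos prod_pos) auto
  ultimately show ?thesis by simp
qed

lemma sum_inverse_squares_le: "(\<Sum>a\<le>m. 1 / (real a + 1)\<^sup>2) \<le> 2"
proof -
  \<comment> \<open>This sharper bound makes the induction telescope.\<close>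
  have "(\<Sum>a\<le>m. 1 / (real a + 1)\<^sup>2) \<le> 2 - 1 / (real m + 1)"
  proof (induction m)
    case (Suc m)
    have "1 / (real m + 2)\<^sup>2 \<le> 1 / (real m + 1) - 1 / (real m + 2)"
      by (simp add: divide_simps power2_eq_square)
    then show ?case using Suc by (simp add: add.commute)
  qed simp
  also have "\<dots> \<le> 2" by simp
  finally show ?thesis .
qed

text \<open>With \<open>x = a + 1\<close> and \<open>y = m - a + 1\<close>, the inequality
  \<open>(m + 1)^2 \<le> 2 * (x^2 + y^2)\<close> bounds the product of the inverse squares by
  \<open>2 / (m + 1)^2\<close> times their sum, and each inverse square sums to at most 2.\<close>

lemma convolution_inverse_squares_le:
  "(\<Sum>a\<le>m. 1 / (real a + 1)\<^sup>2 * (1 / (real (m - a) + 1)\<^sup>2)) \<le> 8 / (real m + 1)\<^sup>2"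
proof -
  have "1 / (real a + 1)\<^sup>2 * (1 / (real (m - a) + 1)\<^sup>2)
      \<le> 2 / (real m + 1)\<^sup>2 * (1 / (real a + 1)\<^sup>2 + 1 / (real (m - a) + 1)\<^sup>2)" if "a \<le> m" for a
  proof -
    define x y where "x = real a + 1" and "y = real (m - a) + 1"
    have xy: "x > 0" "y > 0" "x + y = real m + 2" using that by (auto simp: x_def y_def)
    have "(real m + 1)\<^sup>2 \<le> (x + y)\<^sup>2" using xy by (intro power_mono) auto
    also have "\<dots> \<le> 2 * (x\<^sup>2 + y\<^sup>2)" using sum_squares_ge_zero[of "x - y" 0]
      by (simp add: power2_eq_square algebra_simps)
    finally have "(real m + 1)\<^sup>2 \<le> 2 * (x\<^sup>2 + y\<^sup>2)" .
    then have "(real m + 1)\<^sup>2 / ((real m + 1)\<^sup>2 * (x\<^sup>2 * y\<^sup>2)) \<le> 2 * (x\<^sup>2 + y\<^sup>2) / ((real m + 1)\<^sup>2 * (x\<^sup>2 * y\<^sup>2))"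
      by (rule divide_right_mono) auto
    moreover have "(real m + 1)\<^sup>2 / ((real m + 1)\<^sup>2 * (x\<^sup>2 * y\<^sup>2)) = 1 / x\<^sup>2 * (1 / y\<^sup>2)"
      using xy by simp
    moreover have "2 * (x\<^sup>2 + y\<^sup>2) / ((real m + 1)\<^sup>2 * (x\<^sup>2 * y\<^sup>2)) = 2 / (real m + 1)\<^sup>2 * (1 / x\<^sup>2 + 1 / y\<^sup>2)"
      using xy by (simp add: field_simps)
    ultimately show ?thesis by (simp add: x_def y_def)
  qed
  then have "(\<Sum>a\<le>m. 1 / (real a + 1)\<^sup>2 * (1 / (real (m - a) + 1)\<^sup>2))
      \<le> (\<Sum>a\<le>m. 2 / (real m + 1)\<^sup>2 * (1 / (real a + 1)\<^sup>2 + 1 / (real (m - a) + 1)\<^sup>2))"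
    by (intro sum_mono) auto
  also have "\<dots> = 2 / (real m + 1)\<^sup>2 * ((\<Sum>a\<le>m. 1 / (real a + 1)\<^sup>2) + (\<Sum>a\<le>m. 1 / (real (m - a) + 1)\<^sup>2))"
    by (simp only: sum.distrib flip: sum_distrib_left)
  also have "(\<Sum>a\<le>m. 1 / (real (m - a) + 1)\<^sup>2) = (\<Sum>a\<le>m. 1 / (real a + 1)\<^sup>2)"
    by (rule sum.reindex_bij_witness[where i = "\<lambda>a. m - a" and j = "\<lambda>a. m - a"]) auto
  also have "2 / (real m + 1)\<^sup>2 * ((\<Sum>a\<le>m. 1 / (real a + 1)\<^sup>2) + (\<Sum>a\<le>m. 1 / (real a + 1)\<^sup>2))
      \<le> 2 / (real m + 1)\<^sup>2 * (2 + 2)"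
    by (intro mult_left_mono add_mono sum_inverse_squares_le) auto
  finally show ?thesis by simp
qed

text \<open>The splittings of \<open>k\<close> form a box and \<open>wt\<close> is a product over
  components, so the sum factors into one-dimensional convolutions, each costing a factor 8.\<close>

lemma wt_convolution:
  fixes k :: "nat^'n::finite"
  shows "(\<Sum>(i, j) \<in> {(i, j). i + j = k}. wt i * wt j) \<le> 8 ^ CARD('n) * wt k"
proof -
  have "(\<Sum>(i, j) \<in> {(i, j). i + j = k}. wt i * wt j) = (\<Sum>i | \<forall>l. i $ l \<le> k $ l. wt i * wt (k - i))"
    using sum.reindex_bij_betw[OF bij_betw_splittings[of k], of "\<lambda>(i, j). wt i * wt j"] by simp
  also have "\<dots> = (\<Prod>l\<in>UNIV. \<Sum>a\<le>k $ l. 1 / (real a + 1)\<^sup>2 * (1 / (real (k $ l - a) + 1)\<^sup>2))"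
    by (subst sum_box_prod[symmetric]) (simp only: wt_def prod.distrib vector_minus_component)
  also have "\<dots> \<le> (\<Prod>l\<in>UNIV. 8 / (real (k $ l) + 1)\<^sup>2)"
    using convolution_inverse_squares_le by (intro prod_mono conjI sum_nonneg) auto
  also have "\<dots> = 8 ^ CARD('n) * wt k" by (simp add: wt_def prod_dividef)
  finally show ?thesis .
qed

text \<open>The degree factors satisfy \<open>(tdeg i + 1) * (tdeg j + 1) \<ge> tdeg k + 1\<close>,
  which leaves the convolution of \<open>wt\<close>.\<close>

lemma wt1_convolution:
  fixes k :: "nat^'n::finite"
  shows "(\<Sum>(i, j) \<in> {(i, j). i + j = k}. wt1 i * wt1 j) \<le> 2 * 8 ^ CARD('n) * wt1 k"
proof -
  have "wt1 i * wt1 j \<le> 2 / (real (tdeg k) + 1) * (wt i * wt j)" if "i + j = k" for i j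
  proof -
    define x y where "x = real (tdeg i) + 1" and "y = real (tdeg j) + 1"
    have k: "real (tdeg k) + 1 = x + y - 1" using that by (auto simp: x_def y_def)
    have xy: "x \<ge> 1" "y \<ge> 1" by (auto simp: x_def y_def)
    have "(x - 1) * (y - 1) \<ge> 0" using xy by simp
    then have "x + y - 1 \<le> x * y" by (simp add: algebra_simps)
    then have "1 / (x * y) \<le> 2 / (x + y - 1)" using xy by (simp add: field_simps)
    then have "1 / (x * y) * (wt i * wt j) \<le> 2 / (x + y - 1) * (wt i * wt j)"
      by (intro mult_right_mono) (auto intro: mult_nonneg_nonneg less_imp_le wt_pos)
    then show ?thesis unfolding k by (simp add: wt1_def x_def y_def)
  qed
  then have "(\<Sum>(i, j) \<in> {(i, j). i + j = k}. wt1 i * wt1 j)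
      \<le> (\<Sum>(i, j) \<in> {(i, j). i + j = k}. 2 / (real (tdeg k) + 1) * (wt i * wt j))"
    by (intro sum_mono) auto
  also have "\<dots> = 2 / (real (tdeg k) + 1) * (\<Sum>(i, j) \<in> {(i, j). i + j = k}. wt i * wt j)"
    by (simp add: sum_distrib_left case_prod_unfold)
  also have "\<dots> \<le> 2 / (real (tdeg k) + 1) * (8 ^ CARD('n) * wt k)"
    by (intro mult_left_mono wt_convolution) auto
  finally show ?thesis by (simp add: wt1_def)
qed

text \<open>Degrees add up along a splitting, so \<open>x ^ tdeg k\<close> factors out of the whole
  sum and only the weights remain to be convolved.\<close>

lemma cauchy_bound_aux:
  fixes f g :: "nat^'n::finite \<Rightarrow> complex" and v :: "nat^'n \<Rightarrow> real"
  assumes "\<And>k. (\<Sum>(i, j) \<in> {(i, j). i + j = k}. v i * v j) \<le> K * v k" and "\<And>k. v k > 0"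
    and "x > 0"
    and f: "\<And>k. cmod (f k) \<le> a * v k / x ^ tdeg k" and g: "\<And>k. cmod (g k) \<le> b * v k / x ^ tdeg k"
  shows "cmod (cauchy f g k) \<le> K * a * b * v k / x ^ tdeg k"
proof -
  have a: "a \<ge> 0" and b: "b \<ge> 0"
    using order_trans[OF norm_ge_zero f[of 0]] order_trans[OF norm_ge_zero g[of 0]] assms(2)[of 0]
    by (auto simp: zero_le_mult_iff)
  have "cmod (cauchy f g k) \<le> (\<Sum>(i, j) \<in> {(i, j). i + j = k}. cmod (f i) * cmod (g j))"
    by (rule norm_cauchy_le)
  also have "\<dots> \<le> (\<Sum>(i, j) \<in> {(i, j). i + j = k}. a * b / x ^ tdeg k * (v i * v j))"
  proof (rule sum_mono, clarify)
    fix i j assume "k = i + j"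
    have "cmod (f i) * cmod (g j) \<le> (a * v i / x ^ tdeg i) * (b * v j / x ^ tdeg j)"
      by (intro mult_mono f g order_trans[OF norm_ge_zero f]) auto
    then show "cmod (f i) * cmod (g j) \<le> a * b / x ^ tdeg (i + j) * (v i * v j)"
      by (simp add: power_add mult_ac)
  qed
  also have "\<dots> = a * b / x ^ tdeg k * (\<Sum>(i, j) \<in> {(i, j). i + j = k}. v i * v j)"
    by (simp add: sum_distrib_left case_prod_unfold)
  also have "\<dots> \<le> a * b / x ^ tdeg k * (K * v k)"
    using a b assms(3) by (intro mult_left_mono assms(1)) auto
  finally show ?thesis by (simp add: mult_ac)
qed

lemmas cauchy_bound = cauchy_bound_aux[where v = wt, OF wt_convolution wt_pos]
lemmas cauchy_bound1 = cauchy_bound_aux[where v = wt1, OF wt1_convolution wt1_pos]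

text \<open>The factor \<open>k $ j + 1\<close> produced by differentiation is compensated by the
  degree factor of \<open>wt1\<close>. The shift of the exponent shows as one more power of
  \<open>x\<close>; \<open>m\<close> allows for powers already present.\<close>

lemma dir_deriv_bound:
  fixes f :: "nat^'n::finite \<Rightarrow> complex"
  assumes "x > 0" and f: "\<And>k. cmod (f k) \<le> a * wt1 k / x ^ (tdeg k + m)"
  shows "cmod (dir_deriv q f k) \<le> (\<Sum>j\<in>UNIV. \<bar>real_of_int (q $ j)\<bar>) * a * wt k / x ^ (tdeg k + m + 1)"
proof -
  have a: "a \<ge> 0"
    using order_trans[OF norm_ge_zero f[of 0]] zero_less_power[OF assms(1), of m]
    by (simp add: zero_le_divide_iff)
  have "cmod (dir_deriv q f k)
      \<le> (\<Sum>j\<in>UNIV. \<bar>real_of_int (q $ j)\<bar> * ((real (k $ j) + 1) * cmod (f (k + axis j 1))))"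
    unfolding dir_deriv_def
  proof (rule order_trans[OF norm_sum], rule sum_mono)
    fix j
    have "cmod (of_nat (k $ j + 1)) = real (k $ j) + 1" by (subst norm_of_nat) simp
    then show "cmod (of_int (q $ j) * (of_nat (k $ j + 1) * f (k + axis j 1)))
        \<le> \<bar>real_of_int (q $ j)\<bar> * ((real (k $ j) + 1) * cmod (f (k + axis j 1)))"
      by (simp only: norm_mult norm_of_int order_refl)
  qed
  also have "\<dots> \<le> (\<Sum>j\<in>UNIV. \<bar>real_of_int (q $ j)\<bar> * (a * wt k / x ^ (tdeg k + m + 1)))"
  proof (intro sum_mono mult_left_mono)
    fix j
    have "(real (k $ j) + 1) * wt1 (k + axis j 1) \<le> (real (tdeg k) + 1) * (wt k / (real (tdeg k) + 2))"
      using component_le_tdeg[of k j] wt_add_le[of k "axis j 1"] wt_pos[of "k + axis j 1"]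
      unfolding wt1_def tdeg_add tdeg_axis by (intro mult_mono) (auto intro!: frac_le)
    also have "\<dots> \<le> wt k" using wt_pos[of k] by (simp add: field_simps)
    finally have *: "(real (k $ j) + 1) * wt1 (k + axis j 1) \<le> wt k" .
    have "(real (k $ j) + 1) * cmod (f (k + axis j 1))
        \<le> (real (k $ j) + 1) * (a * wt1 (k + axis j 1) / x ^ (tdeg k + m + 1))"
      using f[of "k + axis j 1"] by (intro mult_left_mono) auto
    also have "\<dots> = a / x ^ (tdeg k + m + 1) * ((real (k $ j) + 1) * wt1 (k + axis j 1))" by simp
    also have "\<dots> \<le> a / x ^ (tdeg k + m + 1) * wt k"
      using a assms(1) by (intro mult_left_mono *) auto
    finally show "(real (k $ j) + 1) * cmod (f (k + axis j 1)) \<le> a * wt k / x ^ (tdeg k + m + 1)" by simp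
  qed auto
  also have "\<dots> = (\<Sum>j\<in>UNIV. \<bar>real_of_int (q $ j)\<bar>) * (a * wt k / x ^ (tdeg k + m + 1))"
    by (simp only: sum_distrib_right)
  finally show ?thesis by (simp add: mult.assoc)
qed

subsection \<open>The system for \<open>E\<close> and \<open>N\<^sup>0\<close>\<close>

lemma dir_deriv_low_degree:
  assumes "\<And>k. tdeg k < Suc m \<Longrightarrow> f k = 0" and "tdeg k < m"
  shows "dir_deriv q f k = 0"
  using assms by (simp add: dir_deriv_def)

text \<open>Products rather than factors are compared, so that the two sides may differ in one
  factor wherever the other vanishes.\<close>

lemma cauchy_cong:
  assumes "\<And>i j. i + j = k \<Longrightarrow> f i * g j = f' i * g' j"
  shows "cauchy f g k = cauchy f' g' k"
  unfolding cauchy_def using assms by (intro sum.cong) auto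

lemma continuous_on_cauchy:
  assumes "\<And>k. continuous_on S (\<lambda>t. f t k)" and "\<And>k. continuous_on S (\<lambda>t. g t k)"
  shows "continuous_on S (\<lambda>t. cauchy (f t) (g t) k)"
  unfolding cauchy_def case_prod_unfold by (intro continuous_intros assms)

lemma continuous_on_dir_deriv:
  assumes "\<And>k. continuous_on S (\<lambda>t. f t k)"
  shows "continuous_on S (\<lambda>t. dir_deriv q (f t) k)"
  unfolding dir_deriv_def by (intro continuous_intros assms)

lemma has_vector_derivative_cauchy_left:
  assumes "\<And>k. ((\<lambda>t. g t k) has_vector_derivative g' k) F"
  shows "((\<lambda>t. cauchy f (g t) k) has_vector_derivative cauchy f g' k) F"
  unfolding cauchy_def case_prod_unfold by (intro derivative_intros assms)

section \<open>Calculus on the half-line\<close>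

lemma has_vector_derivative_integral_half_line:
  fixes f :: "real \<Rightarrow> complex"
  assumes "continuous_on {0..} f" and "t \<ge> 0"
  shows "((\<lambda>u. integral {0..u} f) has_vector_derivative f t) (at t within {0..})"
proof -
  have "((\<lambda>u. integral {0..u} f) has_vector_derivative f t) (at t within {0..t + 1})"
    using assms by (intro integral_has_vector_derivative continuous_on_subset[OF assms(1)]) auto
  moreover have "at t within {0..t + 1} = at t within {0..}"
    by (rule at_within_nhd[where S = "{..<t + 1}"]) auto
  ultimately show ?thesis by simp
qed

lemma norm_diff_le_of_deriv_le:
  fixes f :: "real \<Rightarrow> complex"
  assumes f: "\<And>t. t \<ge> 0 \<Longrightarrow> (f has_vector_derivative f' t) (at t within {0..})"
    and g: "\<And>t. (g has_real_derivative g' t) (at t)"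
    and le: "\<And>t. t \<ge> 0 \<Longrightarrow> cmod (f' t) \<le> g' t" and ab: "0 \<le> a" "a \<le> b"
  shows "cmod (f b - f a) \<le> g b - g a"
proof (cases "a = b")
  case False
  show ?thesis
  proof (rule differentiable_bound_general[where f' = f' and \<phi>' = g'])
    have "continuous_on {0..} f"
      by (rule continuous_on_vector_derivative) (use f in auto)
    then show "continuous_on {a..b} f" by (rule continuous_on_subset) (use ab in auto)
    show "continuous_on {a..b} g"
      using g by (intro continuous_at_imp_continuous_on) (auto intro: DERIV_isCont)
    show "(g has_vector_derivative g' t) (at t)" for t
      using g by (simp add: has_real_derivative_iff_has_vector_derivative)
    show "(f has_vector_derivative f' t) (at t)" if "a < t" for t
    proof -
      have "at t within {0..} = at t" using that ab by (intro at_within_interior) auto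
      then show ?thesis using f[of t] that ab by simp
    qed
  qed (use ab le False in auto)
qed simp

lemma norm_le_of_deriv_le:
  fixes f :: "real \<Rightarrow> complex"
  assumes "\<And>t. t \<ge> 0 \<Longrightarrow> (f has_vector_derivative f' t) (at t within {0..})"
    and "\<And>t. (g has_real_derivative g' t) (at t)"
    and "\<And>t. t \<ge> 0 \<Longrightarrow> cmod (f' t) \<le> g' t" and "cmod (f 0) \<le> g 0" and "T \<ge> 0"
  shows "cmod (f T) \<le> g T"
  using norm_diff_le_of_deriv_le[of f f' g g' 0 T] assms norm_triangle_ineq2[of "f T" "f 0"] by simp

text \<open>The oscillation after time \<open>t\<close> is at most the tail integral of the
  derivative bound. So the values at integer times form a Cauchy sequence, and the same estimate
  carries the limit over to real times.\<close>

lemma convergent_of_exp_decaying_deriv: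
  fixes f :: "real \<Rightarrow> complex"
  assumes f: "\<And>t. t \<ge> 0 \<Longrightarrow> (f has_vector_derivative f' t) (at t within {0..})"
    and le: "\<And>t. t \<ge> 0 \<Longrightarrow> cmod (f' t) \<le> B * exp (- a * t)" and a: "a > 0"
  obtains l where "(f \<longlongrightarrow> l) at_top"
proof -
  have B: "B \<ge> 0" using order_trans[OF norm_ge_zero le[of 0]] by simp
  \<comment> \<open>This is the integral of the derivative bound from \<open>t\<close> to infinity,
    so \<open>- h\<close> is a primitive of that bound.\<close>
  define h where "h t = B / a * exp (- a * t)" for t
  have diff: "cmod (f v - f u) \<le> h u" if uv: "0 \<le> u" "u \<le> v" for u v
  proof -
    have "cmod (f v - f u) \<le> - h v - - h u"
    proof (rule norm_diff_le_of_deriv_le[OF f _ le uv])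
      show "((\<lambda>t. - h t) has_real_derivative B * exp (- a * t)) (at t)" for t
        unfolding h_def using a by (auto intro!: derivative_eq_intros)
    qed
    moreover have "h v \<ge> 0" using B a by (simp add: h_def)
    ultimately show ?thesis by simp
  qed
  have h0: "(h \<longlongrightarrow> 0) at_top"
  proof -
    have "((\<lambda>t. B / a * exp (- a * t)) \<longlongrightarrow> B / a * 0) at_top"
      by (intro tendsto_mult_left filterlim_compose[OF exp_at_bot]
          filterlim_tendsto_neg_mult_at_bot[OF tendsto_const _ filterlim_ident]) (use a in auto)
    then show ?thesis by (simp add: h_def[abs_def])
  qed
  have "Cauchy (\<lambda>n. f (real n))"
  proof (rule CauchyI')
    fix e :: real assume "e > 0"
    then have "\<forall>\<^sub>F n in sequentially. h (real n) < e"
      using order_tendstoD(2)[OF filterlim_compose[OF h0 filterlim_real_sequentially]] by simp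
    then obtain M where M: "\<And>n. n \<ge> M \<Longrightarrow> h (real n) < e" by (auto simp: eventually_sequentially)
    have "dist (f (real m)) (f (real n)) < e" if "m \<ge> M" "n > m" for m n
      using diff[of "real m" "real n"] M[of m] that by (simp add: dist_norm norm_minus_commute)
    then show "\<exists>M. \<forall>m\<ge>M. \<forall>n>m. dist (f (real m)) (f (real n)) < e" by blast
  qed
  then obtain l where l: "(\<lambda>n. f (real n)) \<longlonglongrightarrow> l"
    using Cauchy_convergent[of "\<lambda>n. f (real n)"] by (auto simp only: convergent_def)
  have "cmod (f t - l) \<le> h t" if t: "t \<ge> 0" for t
  proof (rule tendsto_upperbound)
    show "(\<lambda>n. cmod (f t - f (real n))) \<longlonglongrightarrow> cmod (f t - l)"
      by (intro tendsto_intros l)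
    show "\<forall>\<^sub>F n in sequentially. cmod (f t - f (real n)) \<le> h t"
      using eventually_ge_at_top[of "nat \<lceil>t\<rceil>"]
    proof eventually_elim
      case (elim n)
      then have "t \<le> real n" by linarith
      then show ?case using diff[OF t, of "real n"] by (simp add: norm_minus_commute)
    qed
  qed simp
  then have "\<forall>\<^sub>F t in at_top. cmod (f t - l) \<le> h t"
    by (rule eventually_at_top_linorderI)
  then have "((\<lambda>t. f t - l) \<longlongrightarrow> 0) at_top"
    by (rule Lim_null_comparison[OF _ h0])
  then have "(f \<longlongrightarrow> l) at_top" by (simp add: Lim_null[symmetric])
  then show thesis by (rule that)
qed

text \<open>\<open>G\<close> and \<open>n0\<close> are the coefficients of
  \<open>\<kappa>^[q] N^-q N^q\<close> and \<open>N^0\<close> at time 0.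
  \<open>\<alpha>_large\<close> lets the majorant of \<open>N^0\<close> absorb the forcing by
  \<open>G\<close>, and \<open>\<alpha>_small\<close> keeps its derivative small against
  \<open>w\<close>. For small \<open>s0\<close> the two are compatible when \<open>\<mu>\<close> and
  \<open>\<alpha>\<close> are both of order \<open>s0 ^ 3\<close>.\<close>

locale normal_flow =
  fixes q :: "int^'n::finite" and G n0 :: "nat^'n \<Rightarrow> complex" and w s0 \<mu> \<alpha> Q :: real
  defines "Q \<equiv> \<Sum>j\<in>UNIV. \<bar>real_of_int (q $ j)\<bar>"
  assumes w_pos: "w > 0" and s0_pos: "s0 > 0"
    and G_low: "\<And>k. tdeg k < 3 \<Longrightarrow> G k = 0" and n0_low: "\<And>k. tdeg k < 2 \<Longrightarrow> n0 k = 0"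
    and G_bound: "\<And>k. cmod (G k) \<le> \<mu> * wt1 k / s0 ^ tdeg k"
    and n0_bound: "\<And>k. cmod (n0 k) \<le> \<alpha> * wt1 k / s0 ^ (tdeg k + 1)"
    and \<alpha>_large: "2 * (Q * ((2 * 8 ^ CARD('n))\<^sup>2 * \<mu>)) \<le> \<alpha> * w / 8"
    and \<alpha>_small: "8 ^ CARD('n) * (4 * Q * \<alpha> / s0\<^sup>2) \<le> w / 8"
begin

definition s :: "real \<Rightarrow> real" where
  "s t = s0 * (1 + exp (- (w / 4) * t)) / 2"

lemma s_gt: "s0 / 2 < s t"
  using s0_pos by (simp add: s_def field_simps)

lemma s_pos: "s t > 0"
  using s_gt[of t] s0_pos by simp

lemma s_le: "t \<ge> 0 \<Longrightarrow> s t \<le> s0"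
  using s0_pos w_pos by (simp add: s_def field_simps)

lemma s_0 [simp]: "s 0 = s0"
  by (simp add: s_def)

text \<open>Differentiating a negative power of the shrinking radius brings down its exponent. With
  exponents that grow like the degree, this is the term that recovers a lost derivative.\<close>

lemma DERIV_inverse_s_power:
  "((\<lambda>t. 1 / s t ^ m) has_real_derivative
     real m * (s0 * (w / 8) * exp (- (w / 4) * t)) / s t ^ (m + 1)) (at t)"
proof -
  have "(s has_real_derivative - (s0 * (w / 8) * exp (- (w / 4) * t))) (at t)"
    unfolding s_def by (auto intro!: derivative_eq_intros)
  then have "((\<lambda>t. 1 / s t ^ m) has_real_derivative
      - (real m * (- (s0 * (w / 8) * exp (- (w / 4) * t))) * s t ^ (m - 1)) / (s t ^ m)\<^sup>2) (at t)"
    using s_pos[of t] by (auto intro!: derivative_eq_intros simp: power2_eq_square)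
  \<comment> \<open>For \<open>m = 0\<close> the truncated exponent \<open>m - 1\<close> does no
    harm, since the factor \<open>real m\<close> vanishes.\<close>
  moreover have "- (real m * (- (s0 * (w / 8) * exp (- (w / 4) * t))) * s t ^ (m - 1)) / (s t ^ m)\<^sup>2
      = real m * (s0 * (w / 8) * exp (- (w / 4) * t)) / s t ^ (m + 1)"
    using s_pos[of t] by (cases m) (simp_all add: power2_eq_square)
  ultimately show ?thesis by simp
qed

section \<open>The Picard map and its invariant ball of majorants\<close>

definition rate_N :: "(real \<Rightarrow> nat^'n \<Rightarrow> complex) \<Rightarrow> real \<Rightarrow> nat^'n \<Rightarrow> complex" where
  "rate_N E t k = - 2 * dir_deriv q (cauchy G (cauchy (E t) (E t))) k * of_real (exp (- 2 * w * t))"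

text \<open>The second unknown is eliminated by integration, so that the fixed point problem is one
  for \<open>E\<close> alone.\<close>

definition N_of :: "(real \<Rightarrow> nat^'n \<Rightarrow> complex) \<Rightarrow> real \<Rightarrow> nat^'n \<Rightarrow> complex" where
  "N_of E t k = n0 k + integral {0..t} (\<lambda>\<tau>. rate_N E \<tau> k)"

definition rate_E :: "(real \<Rightarrow> nat^'n \<Rightarrow> complex) \<Rightarrow> real \<Rightarrow> nat^'n \<Rightarrow> complex" where
  "rate_E E t k = - cauchy (E t) (dir_deriv q (N_of E t)) k"

definition Picard :: "(real \<Rightarrow> nat^'n \<Rightarrow> complex) \<Rightarrow> real \<Rightarrow> nat^'n \<Rightarrow> complex" where
  "Picard E t k = unit_coeff k + integral {0..t} (\<lambda>\<tau>. rate_E E \<tau> k)"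

definition regular :: "(real \<Rightarrow> nat^'n \<Rightarrow> complex) \<Rightarrow> bool" where
  "regular E \<longleftrightarrow> (\<forall>k. continuous_on {0..} (\<lambda>t. E t k))"

text \<open>
  Without the factor \<^term>\<open>1 / (real (tdeg k) + 1)\<close> of \<^const>\<open>wt1\<close>, which pays for one derivative,
  the solution obeys the smaller exponential rate; this gap of rates lets the shrinking radius
  \<^const>\<open>s\<close> recover the lost derivative.
\<close>

definition bounded_flow :: "(real \<Rightarrow> nat^'n \<Rightarrow> complex) \<Rightarrow> bool" where
  "bounded_flow E \<longleftrightarrow> (\<forall>t\<ge>0. \<forall>k.
     cmod (E t k) \<le> exp (w / 2 * t) * wt k / s t ^ tdeg k \<and>
     cmod (E t k) \<le> exp (3 * w / 4 * t) * wt1 k / s t ^ tdeg k)"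

lemma continuous_rate_N:
  assumes "regular E" shows "continuous_on {0..} (\<lambda>t. rate_N E t k)"
proof -
  have E: "continuous_on {0..} (\<lambda>t. E t k)" for k using assms by (simp add: regular_def)
  show ?thesis unfolding rate_N_def
    by (intro continuous_intros continuous_on_dir_deriv continuous_on_cauchy E)
qed

lemma N_of_0: "N_of E 0 = n0"
  by (simp add: N_of_def fun_eq_iff)

lemma N_of_deriv:
  assumes "regular E" and "t \<ge> 0"
  shows "((\<lambda>t. N_of E t k) has_vector_derivative rate_N E t k) (at t within {0..})"
  unfolding N_of_def
  using has_vector_derivative_add[OF has_vector_derivative_const
      has_vector_derivative_integral_half_line[OF continuous_rate_N[OF assms(1)] assms(2)]]
  by simp

lemma continuous_rate_E:
  assumes "regular E" shows "continuous_on {0..} (\<lambda>t. rate_E E t k)"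
proof -
  have E: "continuous_on {0..} (\<lambda>t. E t k)" for k using assms by (simp add: regular_def)
  have N: "continuous_on {0..} (\<lambda>t. N_of E t k)" for k
    by (rule continuous_on_vector_derivative) (use N_of_deriv[OF assms] in auto)
  show ?thesis unfolding rate_E_def
    by (intro continuous_intros continuous_on_dir_deriv continuous_on_cauchy E N)
qed

lemma Picard_deriv:
  assumes "regular E" and "t \<ge> 0"
  shows "((\<lambda>t. Picard E t k) has_vector_derivative rate_E E t k) (at t within {0..})"
  unfolding Picard_def
  using has_vector_derivative_add[OF has_vector_derivative_const
      has_vector_derivative_integral_half_line[OF continuous_rate_E[OF assms(1)] assms(2)]]
  by simp

lemma regular_Picard:
  assumes "regular E" shows "regular (Picard E)"
  unfolding regular_def
  using continuous_on_vector_derivative[OF Picard_deriv[OF assms]] by auto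

text \<open>The derivative calls for the \<open>wt1\<close> bound of \<open>E\<close>. Two factors
  growing at rate \<open>3 * w / 4\<close> against \<open>exp (- 2 * w * t)\<close> leave decay at
  rate \<open>w / 2\<close>, weakened to \<open>w / 4\<close>, the rate of \<open>s\<close>;
  \<open>\<alpha>_large\<close> absorbs the constants.\<close>

lemma rate_N_bound:
  assumes E: "bounded_flow E" and t: "t \<ge> 0"
  shows "cmod (rate_N E t k) \<le> \<alpha> * wt k * (w / 8 * exp (- (w / 4) * t)) / s t ^ (tdeg k + 1)"
proof -
  define K :: real where "K = 2 * 8 ^ CARD('n)"
  define e where "e = exp (3 * w / 4 * t)"
  have Q: "Q \<ge> 0" by (simp add: Q_def sum_nonneg)
  have \<mu>: "\<mu> \<ge> 0"
    using order_trans[OF norm_ge_zero G_bound[of 0]] by simp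
  have "cmod (cauchy (E t) (E t) k) \<le> K * e * e * wt1 k / s t ^ tdeg k" for k
    using E t unfolding K_def e_def bounded_flow_def by (intro cauchy_bound1 s_pos) auto
  moreover have "cmod (G k) \<le> \<mu> * wt1 k / s t ^ tdeg k" for k
    using s_le[OF t] s_pos[of t] wt1_pos[of k] \<mu>
    by (intro order_trans[OF G_bound] divide_left_mono power_mono mult_pos_pos mult_nonneg_nonneg) auto
  ultimately have "cmod (cauchy G (cauchy (E t) (E t)) k)
      \<le> K * \<mu> * (K * e * e) * wt1 k / s t ^ (tdeg k + 0)" for k
    using cauchy_bound1[OF s_pos, of G \<mu> t "cauchy (E t) (E t)" "K * e * e" k] by (simp add: K_def)
  then have D: "cmod (dir_deriv q (cauchy G (cauchy (E t) (E t))) k)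
      \<le> Q * (K * \<mu> * (K * e * e)) * wt k / s t ^ (tdeg k + 0 + 1)"
    unfolding Q_def by (intro dir_deriv_bound s_pos)
  have ee: "e * e * exp (- 2 * w * t) \<le> exp (- (w / 4) * t)"
    using w_pos t unfolding e_def by (simp flip: exp_add add: field_simps)
  have "cmod (rate_N E t k) = 2 * cmod (dir_deriv q (cauchy G (cauchy (E t) (E t))) k) * exp (- 2 * w * t)"
    by (simp add: rate_N_def norm_mult)
  also have "\<dots> \<le> 2 * (Q * (K * \<mu> * (K * e * e)) * wt k / s t ^ (tdeg k + 0 + 1)) * exp (- 2 * w * t)"
    by (intro mult_right_mono mult_left_mono D) auto
  also have "\<dots> = (2 * (Q * (K\<^sup>2 * \<mu>))) * (wt k / s t ^ (tdeg k + 1)) * (e * e * exp (- 2 * w * t))"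
    by (simp add: power2_eq_square)
  also have "\<dots> \<le> (\<alpha> * w / 8) * (wt k / s t ^ (tdeg k + 1)) * exp (- (w / 4) * t)"
    using \<alpha>_large Q \<mu> s_pos[of t] wt_pos[of k] unfolding K_def
    by (intro mult_mono ee order_trans[OF _ \<alpha>_large] mult_nonneg_nonneg divide_nonneg_pos) (auto simp: e_def)
  finally show ?thesis by (simp add: mult_ac)
qed

lemma \<alpha>_nonneg: "\<alpha> \<ge> 0"
  using order_trans[OF norm_ge_zero n0_bound[of 0]] s0_pos by (simp add: zero_le_divide_iff)

text \<open>The majorant is a supersolution: its exponent \<open>tdeg k + 1\<close> is brought down
  by the time derivative, turns \<open>wt1\<close> into \<open>wt\<close> and so makes the
  derivative dominate \<open>rate_N\<close>.\<close>

lemma N_of_bound: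
  assumes "regular E" "bounded_flow E" "t \<ge> 0"
  shows "cmod (N_of E t k) \<le> \<alpha> * wt1 k / s t ^ (tdeg k + 1)"
proof -
  have "cmod (N_of E t k) \<le> \<alpha> * wt1 k * (1 / s t ^ (tdeg k + 1))"
  proof (rule norm_le_of_deriv_le[OF N_of_deriv[OF assms(1)] DERIV_cmult[OF DERIV_inverse_s_power]])
    fix t :: real assume t: "t \<ge> 0"
    have "cmod (rate_N E t k) \<le> \<alpha> * wt k * (w / 8 * exp (- (w / 4) * t)) / s t ^ (tdeg k + 1)"
      by (rule rate_N_bound[OF assms(2) t])
    also have "\<dots> = \<alpha> * wt k * (w / 8 * exp (- (w / 4) * t)) * s t / s t ^ (tdeg k + 1 + 1)"
      using s_pos[of t] by simp
    also have "\<dots> \<le> \<alpha> * wt k * (w / 8 * exp (- (w / 4) * t)) * s0 / s t ^ (tdeg k + 1 + 1)"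
      using s_pos[of t] s_le[OF t] \<alpha>_nonneg w_pos wt_pos[of k]
      by (intro divide_right_mono mult_left_mono) auto
    finally show "cmod (rate_N E t k) \<le> \<alpha> * wt1 k *
        (real (tdeg k + 1) * (s0 * (w / 8) * exp (- (w / 4) * t)) / s t ^ (tdeg k + 1 + 1))"
      unfolding wt_eq by (simp add: mult_ac add_ac)
  qed (use n0_bound[of k] assms in \<open>simp_all add: N_of_0\<close>)
  then show ?thesis by simp
qed

text \<open>Two surplus powers of \<open>1 / s t\<close>, one from the majorant of
  \<open>N_of\<close> and one from the derivative, are replaced by powers of \<open>2 / s0\<close>,
  since the radius stays above \<open>s0 / 2\<close>.\<close>

lemma N_of_dir_deriv_bound:
  assumes "regular E" "bounded_flow E" "t \<ge> 0"
  shows "cmod (dir_deriv q (N_of E t) k) \<le> 4 * Q * \<alpha> / s0\<^sup>2 * wt k / s t ^ tdeg k"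
proof -
  have Q: "Q \<ge> 0" by (simp add: Q_def sum_nonneg)
  have "cmod (dir_deriv q (N_of E t) k) \<le> Q * \<alpha> * wt k / s t ^ (tdeg k + 1 + 1)"
    unfolding Q_def by (intro dir_deriv_bound s_pos N_of_bound assms)
  also have "\<dots> = Q * \<alpha> * wt k / s t ^ tdeg k / (s t)\<^sup>2"
    by (simp add: power2_eq_square mult_ac)
  also have "\<dots> \<le> Q * \<alpha> * wt k / s t ^ tdeg k / (s0 / 2)\<^sup>2"
    using s_gt[of t] s_pos[of t] s0_pos Q \<alpha>_nonneg wt_pos[of k]
    by (intro divide_left_mono power_mono divide_nonneg_pos mult_nonneg_nonneg mult_pos_pos) auto
  finally show ?thesis by (simp add: power2_eq_square mult_ac)
qed

text \<open>The derivative of \<open>N_of\<close> is controlled only with \<open>wt\<close>, so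
  \<open>E\<close> enters with its \<open>wt\<close> bound and the smaller rate. By
  \<open>\<alpha>_small\<close> the product costs at most \<open>w / 8\<close>.\<close>

lemma rate_E_bound:
  assumes "regular E" "bounded_flow E" "t \<ge> 0"
  shows "cmod (rate_E E t k) \<le> w / 8 * exp (w / 2 * t) * wt k / s t ^ tdeg k"
proof -
  have "cmod (rate_E E t k)
      \<le> 8 ^ CARD('n) * exp (w / 2 * t) * (4 * Q * \<alpha> / s0\<^sup>2) * wt k / s t ^ tdeg k"
    unfolding rate_E_def norm_minus_cancel
    using assms(2,3) N_of_dir_deriv_bound[OF assms] unfolding bounded_flow_def
    by (intro cauchy_bound s_pos) auto
  also have "\<dots> = (8 ^ CARD('n) * (4 * Q * \<alpha> / s0\<^sup>2)) * (exp (w / 2 * t) * wt k / s t ^ tdeg k)"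
    by simp
  also have "\<dots> \<le> w / 8 * (exp (w / 2 * t) * wt k / s t ^ tdeg k)"
    using wt_pos[of k] s_pos[of t] by (intro mult_right_mono \<alpha>_small) auto
  finally show ?thesis by simp
qed

lemma unit_coeff_le_wt1: "cmod (unit_coeff k) \<le> wt1 k / s0 ^ tdeg k"
  using wt1_pos[of k] s0_pos by (auto simp: unit_coeff_def)

lemma unit_coeff_le_wt: "cmod (unit_coeff k) \<le> wt k / s0 ^ tdeg k"
  using wt_pos[of k] s0_pos by (auto simp: unit_coeff_def)

lemma Picard_0: "Picard E 0 = unit_coeff"
  by (simp add: Picard_def fun_eq_iff)

text \<open>Both majorants are supersolutions. For \<open>wt\<close> the growth of the exponential
  alone dominates \<open>rate_E\<close>; for \<open>wt1\<close> the shrinking radius has to supply a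
  factor \<open>tdeg k\<close>.\<close>

lemma bounded_flow_Picard:
  assumes "regular E" "bounded_flow E"
  shows "bounded_flow (Picard E)"
  unfolding bounded_flow_def
proof (intro allI impI conjI)
  fix T :: real and k :: "nat^'n" assume T: "T \<ge> 0"
  have dexp: "((\<lambda>t. exp (r * t) * (v * (1 / s t ^ m))) has_real_derivative
      r * exp (r * t) * (v * (1 / s t ^ m)) +
      exp (r * t) * (v * (real m * (s0 * (w / 8) * exp (- (w / 4) * t)) / s t ^ (m + 1)))) (at t)"
    for r v t :: real and m
  proof -
    have "((\<lambda>t. exp (r * t)) has_real_derivative r * exp (r * t)) (at t)"
      by (auto intro!: derivative_eq_intros)
    from DERIV_mult[OF this DERIV_cmult[OF DERIV_inverse_s_power[of m t], of v]] show ?thesis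
      by (simp add: mult_ac add.commute)
  qed
  have "cmod (Picard E T k) \<le> exp (w / 2 * T) * (wt k * (1 / s T ^ tdeg k))"
  proof (rule norm_le_of_deriv_le[OF Picard_deriv[OF assms(1)] dexp])
    fix t :: real assume t: "t \<ge> 0"
    have "cmod (rate_E E t k) \<le> w / 8 * exp (w / 2 * t) * wt k / s t ^ tdeg k"
      by (rule rate_E_bound[OF assms t])
    also have "\<dots> = w / 8 * (exp (w / 2 * t) * wt k / s t ^ tdeg k)" by simp
    also have "\<dots> \<le> w / 2 * (exp (w / 2 * t) * wt k / s t ^ tdeg k)"
      using w_pos s_pos[of t] wt_pos[of k] by (intro mult_right_mono) auto
    also have "\<dots> \<le> w / 2 * (exp (w / 2 * t) * wt k / s t ^ tdeg k) + exp (w / 2 * t) *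
        (wt k * (real (tdeg k) * (s0 * (w / 8) * exp (- (w / 4) * t)) / s t ^ (tdeg k + 1)))"
      using w_pos s_pos[of t] s0_pos wt_pos[of k] by simp
    finally show "cmod (rate_E E t k) \<le> w / 2 * exp (w / 2 * t) * (wt k * (1 / s t ^ tdeg k)) +
        exp (w / 2 * t) *
        (wt k * (real (tdeg k) * (s0 * (w / 8) * exp (- (w / 4) * t)) / s t ^ (tdeg k + 1)))"
      by simp
  qed (use T unit_coeff_le_wt[of k] in \<open>simp_all add: Picard_0\<close>)
  then show "cmod (Picard E T k) \<le> exp (w / 2 * T) * wt k / s T ^ tdeg k" by simp
  have "cmod (Picard E T k) \<le> exp (3 * w / 4 * T) * (wt1 k * (1 / s T ^ tdeg k))"
  proof (rule norm_le_of_deriv_le[OF Picard_deriv[OF assms(1)] dexp])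
    fix t :: real assume t: "t \<ge> 0"
    define d where "d = tdeg k"
    \<comment> \<open>The decay rate of \<open>s\<close> accounts exactly for the gap between the
      two growth rates.\<close>
    have e: "exp (3 * w / 4 * t) * exp (- (w / 4) * t) = exp (w / 2 * t)"
      by (simp flip: exp_add add: field_simps)
    have "cmod (rate_E E t k) \<le> w / 8 * exp (w / 2 * t) * wt k / s t ^ tdeg k"
      by (rule rate_E_bound[OF assms t])
    \<comment> \<open>\<open>wt k\<close> is \<open>wt1 k\<close> plus \<open>tdeg k\<close> times
      \<open>wt1 k\<close>. The first part is dominated by the growth of the exponential, the second
      by the derivative of \<open>1 / s t ^ d\<close>.\<close>
    also have "\<dots> = w / 8 * exp (w / 2 * t) * (wt1 k / s t ^ d)
        + real d * (w / 8) * exp (w / 2 * t) * (wt1 k / s t ^ d)"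
      unfolding wt_eq d_def by (simp add: algebra_simps add_divide_distrib)
    also have "\<dots> \<le> 3 * w / 4 * exp (3 * w / 4 * t) * (wt1 k / s t ^ d)
        + real d * (w / 8) * exp (w / 2 * t) * (wt1 k / s t ^ d * (s0 / s t))"
    proof (intro add_mono mult_mono mult_left_mono)
      have "1 \<le> s0 / s t" using s_pos[of t] s_le[OF t] by simp
      then show "wt1 k / s t ^ d \<le> wt1 k / s t ^ d * (s0 / s t)"
        using mult_left_mono[of 1 "s0 / s t" "wt1 k / s t ^ d"] s_pos[of t] wt1_pos[of k] by simp
    qed (use w_pos t s_pos[of t] wt1_pos[of k] in \<open>auto simp: less_imp_le\<close>)
    finally show "cmod (rate_E E t k) \<le> 3 * w / 4 * exp (3 * w / 4 * t) * (wt1 k * (1 / s t ^ tdeg k)) +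
        exp (3 * w / 4 * t) *
        (wt1 k * (real (tdeg k) * (s0 * (w / 8) * exp (- (w / 4) * t)) / s t ^ (tdeg k + 1)))"
      unfolding d_def e[symmetric] by (simp add: mult_ac)
  qed (use T unit_coeff_le_wt1[of k] in \<open>simp_all add: Picard_0\<close>)
  then show "cmod (Picard E T k) \<le> exp (3 * w / 4 * T) * wt1 k / s T ^ tdeg k" by simp
qed

section \<open>Triangular structure and the fixed point\<close>

lemma N_of_low:
  assumes "tdeg k < 2"
  shows "N_of E t k = 0"
proof -
  have "cauchy G (cauchy (E \<tau>) (E \<tau>)) k = 0" if "tdeg k < Suc 2" for \<tau> k
    by (rule cauchy_low_degree[where m = 3 and n = 0]) (use that G_low in auto)
  then have "rate_N E \<tau> k = 0" for \<tau>
    using dir_deriv_low_degree[OF _ assms, where q = q] by (simp add: rate_N_def)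
  then show ?thesis using n0_low[OF assms] by (simp add: N_of_def)
qed

text \<open>Each step gains one degree. As \<open>G\<close> starts in degree 3 and one derivative is
  lost, \<open>N_of\<close> agrees below degree \<open>d + 2\<close>. As the derivative of
  \<open>N_of\<close> starts in degree 1, a coefficient of \<open>rate_E\<close> of degree at most
  \<open>d\<close> sees \<open>E\<close> itself only below degree \<open>d\<close>.\<close>

lemma Picard_agree:
  assumes E: "\<And>t k. tdeg k < d \<Longrightarrow> E t k = E' t k" and "tdeg k < Suc d"
  shows "Picard E t k = Picard E' t k"
proof -
  have EE: "cauchy (E \<tau>) (E \<tau>) k = cauchy (E' \<tau>) (E' \<tau>) k" if "tdeg k < d" for \<tau> k
    by (rule cauchy_cong) (use that E in auto)
  have GEE: "cauchy G (cauchy (E \<tau>) (E \<tau>)) k = cauchy G (cauchy (E' \<tau>) (E' \<tau>)) k"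
    if "tdeg k < d + 3" for \<tau> k
  proof (rule cauchy_cong)
    fix i j assume ij: "i + j = k"
    show "G i * cauchy (E \<tau>) (E \<tau>) j = G i * cauchy (E' \<tau>) (E' \<tau>) j"
    proof (cases "tdeg i < 3")
      case False
      then have "tdeg j < d" using ij that by auto
      then show ?thesis by (simp add: EE)
    qed (simp add: G_low)
  qed
  have N: "N_of E \<tau> k = N_of E' \<tau> k" if "tdeg k < d + 2" for \<tau> k
    using that by (simp add: N_of_def rate_N_def dir_deriv_def GEE)
  have "rate_E E \<tau> k = rate_E E' \<tau> k" for \<tau>
    unfolding rate_E_def neg_equal_iff_equal
  proof (rule cauchy_cong)
    fix i j assume ij: "i + j = k"
    show "E \<tau> i * dir_deriv q (N_of E \<tau>) j = E' \<tau> i * dir_deriv q (N_of E' \<tau>) j"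
    proof (cases "tdeg j < 1")
      case True
      then have "dir_deriv q (N_of E \<tau>) j = 0" "dir_deriv q (N_of E' \<tau>) j = 0"
        using True by (auto intro!: dir_deriv_low_degree[where m = 1] N_of_low)
      then show ?thesis by simp
    next
      case False
      then have "tdeg i < d" "tdeg j < d + 1" using ij assms(2) by auto
      then show ?thesis by (simp add: E N dir_deriv_def)
    qed
  qed
  then show ?thesis by (simp add: Picard_def)
qed

definition iter :: "nat \<Rightarrow> real \<Rightarrow> nat^'n \<Rightarrow> complex" where
  "iter m = (Picard ^^ m) (\<lambda>t. unit_coeff)"

lemma iter_regular_bounded: "regular (iter m) \<and> bounded_flow (iter m)"
proof (induction m)
  case 0
  have "cmod (unit_coeff k) \<le> exp (w / 2 * t) * wt k / s t ^ tdeg k \<and>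
      cmod (unit_coeff k) \<le> exp (3 * w / 4 * t) * wt1 k / s t ^ tdeg k" if "t \<ge> 0" for t k
    using w_pos that s_pos[of t] wt_pos[of k] wt1_pos[of k] by (auto simp: unit_coeff_def)
  then show ?case by (auto simp: iter_def regular_def bounded_flow_def simp del: times_divide_eq_left)
next
  case (Suc m)
  then show ?case using regular_Picard bounded_flow_Picard by (simp add: iter_def)
qed

lemma iter_Suc_agree: "tdeg k < m \<Longrightarrow> iter (Suc m) t k = iter m t k"
proof (induction m arbitrary: t k)
  case (Suc m)
  then show ?case using Picard_agree[of m "iter (Suc m)" "iter m" k t] by (simp add: iter_def)
qed simp

text \<open>Coefficient \<open>k\<close> is stationary from iterate \<open>tdeg k + 1\<close> on.
  With this value taken, bounds shared by all iterates pass to the limit.\<close>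

definition flow :: "real \<Rightarrow> nat^'n \<Rightarrow> complex" where
  "flow t k = iter (Suc (tdeg k)) t k"

lemma flow_eq_iter:
  assumes "tdeg k < m" shows "flow t k = iter m t k"
proof -
  have "Suc (tdeg k) \<le> m" using assms by simp
  then have "iter m t k = iter (Suc (tdeg k)) t k"
    by (induction m rule: dec_induct) (auto simp: iter_Suc_agree)
  then show ?thesis by (simp add: flow_def)
qed

text \<open>A coefficient of \<open>Picard flow\<close> of degree \<open>d\<close> depends only on
  coefficients below degree \<open>d\<close>, where \<open>flow\<close> equals
  \<open>iter d\<close>; one more Picard step gives \<open>iter (Suc d)\<close>.\<close>

lemma Picard_flow: "Picard flow = flow"
proof (intro ext)
  fix t k
  have "Picard flow t k = Picard (iter (tdeg k)) t k"
    by (rule Picard_agree[where d = "tdeg k"]) (simp_all add: flow_eq_iter)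
  then show "Picard flow t k = flow t k" by (simp add: flow_def iter_def)
qed

lemma regular_flow: "regular flow" and bounded_flow_flow: "bounded_flow flow"
  using iter_regular_bounded by (auto simp: regular_def bounded_flow_def flow_def)

lemma flow_0: "flow 0 = unit_coeff"
  using Picard_0[of flow] by (simp add: Picard_flow)

lemma flow_deriv:
  "t \<ge> 0 \<Longrightarrow> ((\<lambda>t. flow t k) has_vector_derivative rate_E flow t k) (at t within {0..})"
  using Picard_deriv[OF regular_flow] by (simp add: Picard_flow)

end

subsection \<open>Norms of power series in \<open>\<kappa>\<close>\<close>

lemma series_mult_in_kappa:
  fixes f g :: "nat^'n::finite \<Rightarrow> complex"
  shows "in_kappa f \<star> in_kappa g = in_kappa (cauchy f g)"
proof
  fix m :: "'n exponent"
  obtain k kb where m: "m = (k, kb)" by (cases m)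
  show "(in_kappa f \<star> in_kappa g) m = in_kappa (cauchy f g) m"
  proof (cases "k = kb")
    case True
    have "(\<Sum>(i, j) \<in> {(i, j). i + j = (k, k)}. in_kappa f i * in_kappa g j)
        = (\<Sum>(i, j) \<in> {(i, j). i + j = k}. f i * g j)"
    proof -
      \<comment> \<open>A splitting of \<open>(k, k)\<close> contributes only if both parts are
        diagonal; \<open>?e\<close> parametrises these.\<close>
      let ?e = "\<lambda>(a :: nat^'n, b :: nat^'n). ((a, a), (b, b))"
      have inj: "inj_on ?e {(i, j). i + j = k}" by (auto simp: inj_on_def)
      have "(\<Sum>(i, j) \<in> {(i, j). i + j = (k, k)}. in_kappa f i * in_kappa g j)
          = (\<Sum>(i, j) \<in> ?e ` {(i, j). i + j = k}. in_kappa f i * in_kappa g j)"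
        by (rule sum.mono_neutral_right[OF finite_exponent_splittings])
          (auto simp: in_kappa_def image_iff)
      also have "\<dots> = (\<Sum>(i, j) \<in> {(i, j). i + j = k}. f i * g j)"
        by (subst sum.reindex[OF inj]) (simp add: case_prod_unfold in_kappa_def)
      finally show ?thesis .
    qed
    then show ?thesis using True by (simp add: m series_mult_def cauchy_def in_kappa_def)
  next
    case False
    have "(in_kappa f \<star> in_kappa g) m = 0"
      unfolding series_mult_def using False by (intro sum.neutral) (auto simp: in_kappa_def m)
    then show ?thesis using False by (simp add: m in_kappa_def)
  qed
qed

lemma monom_series_mult:
  fixes m k :: "'n::finite exponent"
  shows "(monom_series m \<star> F) (m + k) = F k"
proof -
  have "(monom_series m \<star> F) (m + k) = (\<Sum>(i, j) \<in> {(m, k)}. monom_series m i * F j)"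
    unfolding series_mult_def
  proof (rule sum.mono_neutral_right[OF finite_exponent_splittings])
    show "\<forall>p\<in>{(i, j). i + j = m + k} - {(m, k)}. (case p of (i, j) \<Rightarrow> monom_series m i * F j) = 0"
    proof
      fix p assume "p \<in> {(i, j). i + j = m + k} - {(m, k)}"
      then obtain i j where p: "p = (i, j)" "i + j = m + k" "(i, j) \<noteq> (m, k)" by blast
      then have "i \<noteq> m" using add_left_cancel[of m j k] by blast
      then show "(case p of (i, j) \<Rightarrow> monom_series m i * F j) = 0"
        by (simp add: p(1) monom_series_def)
    qed
  qed simp
  then show ?thesis by (simp add: monom_series_def)
qed

definition monom_kappa :: "nat^'n::finite \<Rightarrow> nat^'n \<Rightarrow> complex" where
  "monom_kappa m k = (if k = m then 1 else 0)"

lemma kappa_abs_eq: "kappa_abs q = in_kappa (monom_kappa (\<chi> j. nat \<bar>q $ j\<bar>))"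
  by (auto simp: kappa_abs_def monom_series_def in_kappa_def monom_kappa_def fun_eq_iff)

lemma dir_deriv_kappa_eq: "dir_deriv_kappa q (in_kappa f) = in_kappa (dir_deriv q f)"
  by (auto simp: dir_deriv_kappa_def deriv_kappa_def in_kappa_def dir_deriv_def fun_eq_iff)

text \<open>The two parts of \<open>min_exponent q\<close> have the total degree of
  \<open>\<kappa>^[q]\<close> in \<kappa>, and \<open>\<kappa>^k\<close> has degree
  \<open>2 * tdeg k\<close> in the original variables.\<close>

lemma low_degree_of_is_O_z:
  fixes q :: "int^'n::finite"
  assumes "is_O_z 3 (monom_series (min_exponent q) \<star> in_kappa f)"
    and "tdeg (\<chi> j. nat \<bar>q $ j\<bar>) + 2 * tdeg k < 3"
  shows "f k = 0"
proof -
  define a b :: "nat^'n" where "a = (\<chi> j. nat (- q $ j))" and "b = (\<chi> j. nat (q $ j))"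
  have "tdeg a + tdeg b = tdeg (\<chi> j. nat \<bar>q $ j\<bar>)"
    unfolding tdeg_def a_def b_def sum.distrib[symmetric] by (rule sum.cong) auto
  then have "tdeg (a + k) + tdeg (b + k) < 3" using assms(2) by simp
  then have "(monom_series (min_exponent q) \<star> in_kappa f) (a + k, b + k) = 0"
    using assms(1) by (auto simp: is_O_z_def tdeg_def)
  moreover have "(a + k, b + k) = min_exponent q + (k, k)"
    by (simp add: min_exponent_eq a_def b_def)
  ultimately show ?thesis by (simp add: monom_series_mult in_kappa_def)
qed

section \<open>Convergence and sup norms on polydiscs\<close>

lemma summable_on_half_power: "(\<lambda>k :: nat^'n::finite. (1 / 2 :: real) ^ tdeg k) summable_on UNIV"
proof (rule nonneg_bdd_above_summable_on)
  have "sum (\<lambda>k. (1 / 2 :: real) ^ tdeg k) F \<le> 2 ^ CARD('n)" if F: "finite F" for F :: "(nat^'n) set"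
  proof -
    \<comment> \<open>Sums of components serve as an upper bound of \<open>F\<close>; over the
      resulting box the sum is a product of geometric sums, each at most 2.\<close>
    define m :: "nat^'n" where "m = (\<chi> l. \<Sum>k\<in>F. k $ l)"
    have "F \<subseteq> {k. \<forall>l. k $ l \<le> m $ l}"
      using F by (auto simp: m_def intro!: member_le_sum)
    then have "sum (\<lambda>k. (1 / 2 :: real) ^ tdeg k) F \<le> (\<Sum>k | \<forall>l. k $ l \<le> m $ l. (1 / 2) ^ tdeg k)"
      by (intro sum_mono2 finite_box) auto
    also have "\<dots> = (\<Prod>l\<in>UNIV. \<Sum>a\<le>m $ l. (1 / 2 :: real) ^ a)"
      by (subst sum_box_prod[symmetric]) (simp add: tdeg_def power_sum)
    also have "\<dots> \<le> (\<Prod>l\<in>(UNIV :: 'n set). 2)"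
    proof (intro prod_mono conjI sum_nonneg)
      show "(\<Sum>a\<le>m $ l. (1 / 2 :: real) ^ a) \<le> 2" for l
        by (simp add: sum_gp0)
    qed auto
    finally show ?thesis by simp
  qed
  then show "bdd_above (sum (\<lambda>k :: nat^'n. (1 / 2 :: real) ^ tdeg k) ` {F. F \<subseteq> UNIV \<and> finite F})"
    by (intro bdd_aboveI2) auto
qed auto

lemma finite_tdeg_less: "finite {k :: nat^'n::finite. tdeg k < d}"
  by (rule finite_subset[OF _ finite_box[of "\<chi> l. d"]])
    (auto intro: order_trans[OF component_le_tdeg])

lemma norm_monom_val_diag_le:
  assumes "p \<in> polydisc \<rho>"
  shows "cmod (monom_val p (k, k)) \<le> (\<rho>\<^sup>2) ^ tdeg k"
proof -
  obtain z zb where p: "p = (z, zb)" by (cases p)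
  have le: "cmod (z $ j) \<le> \<rho>" "cmod (zb $ j) \<le> \<rho>" for j
    using assms by (auto simp: p polydisc_def less_imp_le)
  have "cmod (monom_val p (k, k)) = (\<Prod>j\<in>UNIV. cmod (z $ j) ^ (k $ j)) * (\<Prod>j\<in>UNIV. cmod (zb $ j) ^ (k $ j))"
    by (simp add: p monom_val_def norm_mult norm_power flip: prod_norm)
  also have "\<dots> \<le> (\<Prod>j\<in>UNIV. \<rho> ^ (k $ j)) * (\<Prod>j\<in>UNIV. \<rho> ^ (k $ j))"
    using order_trans[OF norm_ge_zero le(1)]
    by (intro mult_mono prod_mono conjI power_mono le prod_nonneg) auto
  also have "\<dots> = (\<rho>\<^sup>2) ^ tdeg k"
    by (simp add: tdeg_def power_sum power2_eq_square power_mult_distrib prod.distrib)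
  finally show ?thesis .
qed

text \<open>On the polydisc each \<open>\<kappa>_j\<close> is at most \<open>x / 4\<close> in
  modulus. A coefficient bound with radius \<open>x\<close> thus gives terms of size
  \<open>(1 / 4) ^ tdeg k\<close>: one factor \<open>1 / 2\<close> per degree pays for summability,
  the other for small tails.\<close>

locale polydisc_radius =
  fixes \<rho> x :: real
  assumes \<rho>_pos: "\<rho> > 0" and \<rho>_le: "4 * \<rho>\<^sup>2 \<le> x"
begin

lemma x_pos: "x > 0"
  using \<rho>_pos \<rho>_le by (smt (verit) zero_less_power)

text \<open>The argument of type \<open>itself\<close> only fixes the number of variables.\<close>

definition S :: "'n::finite itself \<Rightarrow> real" where
  "S _ = (\<Sum>\<^sub>\<infinity>k :: nat^'n. (1 / 2) ^ tdeg k)"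

lemma term_le:
  assumes "cmod (f k) \<le> C / x ^ tdeg k"
  shows "cmod (f k) * (\<rho>\<^sup>2) ^ tdeg k \<le> C * (1 / 2) ^ tdeg k * (1 / 2) ^ tdeg k"
proof -
  have "C \<ge> 0" using order_trans[OF norm_ge_zero assms] zero_less_power[OF x_pos, of "tdeg k"]
    by (simp add: zero_le_divide_iff)
  have "cmod (f k) * (\<rho>\<^sup>2) ^ tdeg k \<le> C / x ^ tdeg k * (x / 4) ^ tdeg k"
    using assms \<rho>_le x_pos \<open>C \<ge> 0\<close> by (intro mult_mono power_mono) auto
  also have "\<dots> = C * (1 / 2) ^ tdeg k * (1 / 2) ^ tdeg k"
    using x_pos by (simp add: power_divide flip: power_mult_distrib)
  finally show ?thesis .
qed

lemma summable_majorant: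
  fixes f :: "nat^'n::finite \<Rightarrow> complex"
  assumes f: "\<And>k. cmod (f k) \<le> C / x ^ tdeg k"
  shows "(\<lambda>k. cmod (f k) * (\<rho>\<^sup>2) ^ tdeg k) summable_on UNIV"
proof -
  have C: "C \<ge> 0" using order_trans[OF norm_ge_zero f[of 0]] by simp
  have "cmod (f k) * (\<rho>\<^sup>2) ^ tdeg k \<le> C * (1 / 2) ^ tdeg k" for k
    using term_le[of f k, OF f] C power_le_one[of "1 / 2 :: real" "tdeg k"]
      mult_left_mono[of "(1 / 2) ^ tdeg k" 1 "C * (1 / 2) ^ tdeg k"] by simp
  then show ?thesis
    by (intro summable_on_comparison_test[OF summable_on_cmult_right[OF summable_on_half_power, of C]])
      auto
qed

lemma eval_in_kappa:
  fixes f :: "nat^'n::finite \<Rightarrow> complex"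
  assumes f: "\<And>k. cmod (f k) \<le> C / x ^ tdeg k" and p: "p \<in> polydisc \<rho>"
  shows "(\<lambda>k. in_kappa f k * monom_val p k) summable_on UNIV"
    and "cmod (series_eval (in_kappa f) p) \<le> (\<Sum>\<^sub>\<infinity>k. cmod (f k) * (\<rho>\<^sup>2) ^ tdeg k)"
proof -
  let ?h = "\<lambda>k. in_kappa f k * monom_val p k" and ?d = "\<lambda>k :: nat^'n. (k, k)"
  have le: "cmod (f k * monom_val p (k, k)) \<le> cmod (f k) * (\<rho>\<^sup>2) ^ tdeg k" for k
    unfolding norm_mult by (intro mult_left_mono norm_monom_val_diag_le p) auto
  have abs: "(\<lambda>k. cmod (f k * monom_val p (k, k))) summable_on UNIV"
    by (rule summable_on_comparison_test[OF summable_majorant[OF f]]) (use le in auto)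
  have inj: "inj ?d" by (auto simp: inj_on_def)
  have d: "?h \<circ> ?d = (\<lambda>k. f k * monom_val p (k, k))" by (auto simp: in_kappa_def)
  have out: "?h k = 0" if "k \<notin> range ?d" for k
    using that by (cases k) (auto simp: in_kappa_def)
  have "?h summable_on range ?d"
    using summable_on_reindex[OF inj, of ?h] abs_summable_summable[OF abs] by (simp add: d)
  also have "?h summable_on range ?d \<longleftrightarrow> ?h summable_on UNIV"
    by (rule summable_on_cong_neutral) (use out in auto)
  finally show "?h summable_on UNIV" .
  have "series_eval (in_kappa f) p = infsum ?h (range ?d)"
    unfolding series_eval_def by (rule infsum_cong_neutral) (use out in auto)
  also have "\<dots> = (\<Sum>\<^sub>\<infinity>k. f k * monom_val p (k, k))"
    by (simp only: infsum_reindex[OF inj] d)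
  finally have "cmod (series_eval (in_kappa f) p) \<le> (\<Sum>\<^sub>\<infinity>k. cmod (f k * monom_val p (k, k)))"
    using norm_infsum_bound[OF abs] by simp
  also have "\<dots> \<le> (\<Sum>\<^sub>\<infinity>k. cmod (f k) * (\<rho>\<^sup>2) ^ tdeg k)"
    by (intro infsum_mono abs summable_majorant[OF f] le)
  finally show "cmod (series_eval (in_kappa f) p) \<le> (\<Sum>\<^sub>\<infinity>k. cmod (f k) * (\<rho>\<^sup>2) ^ tdeg k)" .
qed

lemma in_analytic_space:
  fixes f :: "nat^'n::finite \<Rightarrow> complex"
  assumes f: "\<And>k. cmod (f k) \<le> C / x ^ tdeg k"
  shows "in_kappa f \<in> analytic_space \<rho>"
  unfolding analytic_space_def
  using eval_in_kappa[OF f] by (auto intro!: bdd_aboveI2)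

lemma zero_in_polydisc: "0 \<in> polydisc \<rho>"
  using \<rho>_pos by (simp add: polydisc_def zero_prod_def)

lemma series_norm_nonneg:
  assumes "H \<in> analytic_space \<rho>"
  shows "series_norm \<rho> H \<ge> 0"
  unfolding series_norm_def
  by (rule order_trans[OF norm_ge_zero cSUP_upper[OF zero_in_polydisc]])
    (use assms in \<open>simp add: analytic_space_def\<close>)

text \<open>The finitely many coefficients below degree \<open>d\<close> are kept, to be sent to 0
  one by one later; the tail is small uniformly by the spare factor \<open>1 / 2\<close> per
  degree.\<close>

lemma series_norm_le:
  fixes f :: "nat^'n::finite \<Rightarrow> complex"
  assumes f: "\<And>k. cmod (f k) \<le> C / x ^ tdeg k"
  shows "series_norm \<rho> (in_kappa f)
    \<le> (\<Sum>k | tdeg k < d. cmod (f k) * (\<rho>\<^sup>2) ^ tdeg k) + C * (1 / 2) ^ d * S TYPE('n)"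
proof -
  have C: "C \<ge> 0" using order_trans[OF norm_ge_zero f[of 0]] by simp
  let ?g = "\<lambda>k. cmod (f k) * (\<rho>\<^sup>2) ^ tdeg k" and ?B = "{k :: nat^'n. tdeg k < d}"
  have "series_norm \<rho> (in_kappa f) \<le> infsum ?g UNIV"
    unfolding series_norm_def using zero_in_polydisc eval_in_kappa(2)[OF f] by (intro cSUP_least) auto
  also have "\<dots> \<le> sum ?g ?B + C * (1 / 2) ^ d * S TYPE('n)"
  proof (rule infsum_le_finite_sums[OF summable_majorant[OF f]])
    fix F :: "(nat^'n) set" assume F: "finite F"
    have "sum ?g F = sum ?g (F \<inter> ?B) + sum ?g (F - ?B)"
      by (rule sum.Int_Diff[OF F])
    also have "\<dots> \<le> sum ?g ?B + (\<Sum>k\<in>F - ?B. C * (1 / 2) ^ d * (1 / 2) ^ tdeg k)"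
    proof (intro add_mono sum_mono2 finite_tdeg_less sum_mono)
      fix k assume "k \<in> F - ?B"
      then have "C * (1 / 2) ^ tdeg k * (1 / 2) ^ tdeg k \<le> C * (1 / 2) ^ d * (1 / 2) ^ tdeg k"
        using C by (intro mult_right_mono mult_left_mono power_decreasing) auto
      then show "?g k \<le> C * (1 / 2) ^ d * (1 / 2) ^ tdeg k"
        using term_le[of f k, OF f] by simp
    qed auto
    also have "(\<Sum>k\<in>F - ?B. C * (1 / 2) ^ d * (1 / 2) ^ tdeg k) \<le> C * (1 / 2) ^ d * S TYPE('n)"
      unfolding sum_distrib_left[symmetric] S_def using C F
      by (intro mult_left_mono finite_sum_le_infsum summable_on_half_power) auto
    finally show "sum ?g F \<le> sum ?g ?B + C * (1 / 2) ^ d * S TYPE('n)" by simp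
  qed
  finally show ?thesis .
qed

text \<open>A dominated convergence argument: \<open>d\<close> is first fixed to make the tails of
  all differences small, then the finite head is made small by coefficientwise convergence.\<close>

lemma norm_limit_in_kappa:
  fixes f :: "'a \<Rightarrow> nat^'n::finite \<Rightarrow> complex"
  assumes f: "\<forall>\<^sub>F t in A. \<forall>k. cmod (f t k) \<le> C / x ^ tdeg k"
    and l: "\<And>k. cmod (l k) \<le> C / x ^ tdeg k"
    and lim: "\<And>k. ((\<lambda>t. f t k) \<longlongrightarrow> l k) A"
  shows "norm_limit \<rho> (\<lambda>t. in_kappa (f t)) (in_kappa l) A"
  unfolding norm_limit_def
proof (intro conjI)
  show "\<forall>\<^sub>F t in A. in_kappa (f t) \<in> analytic_space \<rho>"
    using f by eventually_elim (auto intro: in_analytic_space)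
  show "in_kappa l \<in> analytic_space \<rho>"
    by (rule in_analytic_space[OF l])
  have eq: "(\<lambda>k. in_kappa (f t) k - in_kappa l k) = in_kappa (\<lambda>k. f t k - l k)" for t
    by (auto simp: in_kappa_def)
  have diff: "\<forall>\<^sub>F t in A. \<forall>k. cmod (f t k - l k) \<le> 2 * C / x ^ tdeg k"
    using f
  proof eventually_elim
    case (elim t)
    show ?case
    proof
      fix k
      have "cmod (f t k - l k) \<le> C / x ^ tdeg k + C / x ^ tdeg k"
        by (rule order_trans[OF norm_triangle_ineq4 add_mono]) (use elim l in auto)
      then show "cmod (f t k - l k) \<le> 2 * C / x ^ tdeg k" by simp
    qed
  qed
  have C: "C \<ge> 0" using order_trans[OF norm_ge_zero l[of 0]] by simp
  have S: "S TYPE('n) \<ge> 0" by (simp add: S_def infsum_nonneg)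
  show "((\<lambda>t. series_norm \<rho> (\<lambda>k. in_kappa (f t) k - in_kappa l k)) \<longlongrightarrow> 0) A"
    unfolding eq tendsto_iff
  proof (intro allI impI)
    fix e :: real assume e: "e > 0"
    have "(\<lambda>d. 2 * C * (1 / 2) ^ d * S TYPE('n)) \<longlonglongrightarrow> 2 * C * 0 * S TYPE('n)"
      by (intro tendsto_intros LIMSEQ_power_zero) auto
    then have "\<forall>\<^sub>F d in sequentially. 2 * C * (1 / 2) ^ d * S TYPE('n) < e / 2"
      using e by (intro order_tendstoD(2)) auto
    then obtain d where d: "2 * C * (1 / 2) ^ d * S TYPE('n) < e / 2"
      by (auto simp: eventually_sequentially)
    have "((\<lambda>t. \<Sum>k | tdeg k < d. cmod (f t k - l k) * (\<rho>\<^sup>2) ^ tdeg k)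
        \<longlongrightarrow> (\<Sum>k | tdeg k < d. cmod (l k - l k) * (\<rho>\<^sup>2) ^ tdeg k)) A"
      by (intro tendsto_intros lim)
    then have "\<forall>\<^sub>F t in A. (\<Sum>k | tdeg k < d. cmod (f t k - l k) * (\<rho>\<^sup>2) ^ tdeg k) < e / 2"
      using e by (intro order_tendstoD(2)) auto
    then show "\<forall>\<^sub>F t in A. dist (series_norm \<rho> (in_kappa (\<lambda>k. f t k - l k))) 0 < e"
      using diff
    proof eventually_elim
      case (elim t)
      have b: "\<And>k. cmod (f t k - l k) \<le> 2 * C / x ^ tdeg k" using elim(2) by simp
      show ?case
        using series_norm_le[OF b, of d] series_norm_nonneg[OF in_analytic_space[OF b]] elim(1) d
        by simp
    qed
  qed
qed

text \<open>By the mean value inequality the difference quotients inherit the geometric bound, so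
  coefficientwise derivatives are derivatives in norm. The bound is local in time because those
  available for \<open>N^q\<close> and \<open>N^-q\<close> grow.\<close>

lemma has_norm_deriv_in_kappa:
  fixes f f' :: "real \<Rightarrow> nat^'n::finite \<Rightarrow> complex"
  assumes deriv: "\<And>t k. t \<ge> 0 \<Longrightarrow> ((\<lambda>t. f t k) has_vector_derivative f' t k) (at t within {0..})"
    and bound: "\<And>t k. 0 \<le> t \<Longrightarrow> t \<le> T + 1 \<Longrightarrow> cmod (f' t k) \<le> C / x ^ tdeg k"
    and T: "T \<ge> 0"
  shows "has_norm_deriv \<rho> (\<lambda>t. in_kappa (f t)) (in_kappa (f' T)) T"
proof -
  let ?g = "\<lambda>t k. (f t k - f T k) / of_real (t - T)"
  have eq: "(\<lambda>t k. (in_kappa (f t) k - in_kappa (f T) k) / of_real (t - T)) = (\<lambda>t. in_kappa (?g t))"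
    by (auto simp: in_kappa_def fun_eq_iff)
  have g: "cmod (?g t k - f' T k) = cmod (f t k - f T k - (t - T) *\<^sub>R f' T k) / \<bar>t - T\<bar>"
    if "t \<noteq> T" for t k
  proof -
    have "?g t k - f' T k = (f t k - f T k - (t - T) *\<^sub>R f' T k) / of_real (t - T)"
      using that by (simp add: field_simps scaleR_conv_of_real)
    then show ?thesis by (simp add: norm_divide flip: of_real_diff)
  qed
  have C: "C \<ge> 0" using order_trans[OF norm_ge_zero bound[of T 0]] T by simp
  have "norm_limit \<rho> (\<lambda>t. in_kappa (?g t)) (in_kappa (f' T)) (at T within {0..})"
  proof (rule norm_limit_in_kappa)
    show "\<forall>\<^sub>F t in at T within {0..}. \<forall>k. cmod (?g t k) \<le> 3 * C / x ^ tdeg k"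
      unfolding eventually_at
    proof (intro exI[of _ 1] conjI ballI impI allI)
      fix t k assume t: "t \<in> {0..}" "t \<noteq> T \<and> dist t T < 1"
      \<comment> \<open>On the interval the derivative deviates from its value at \<open>T\<close>
        by at most \<open>2 * C / x ^ tdeg k\<close>; adding that value itself leads to
        \<open>3 * C\<close>.\<close>
      have "cmod (f t k - f T k - (t - T) *\<^sub>R f' T k) \<le> norm (t - T) * (2 * C / x ^ tdeg k)"
      proof (rule vector_differentiable_bound_linearization[where S = "{0..T + 1}"])
        show "((\<lambda>t. f t k) has_vector_derivative f' u k) (at u within {0..T + 1})"
          if "u \<in> {0..T + 1}" for u
          by (rule has_vector_derivative_within_subset[OF deriv]) (use that in auto)
        show "closed_segment T t \<subseteq> {0..T + 1}"
          using t T by (auto simp: closed_segment_eq_real_ivl dist_real_def split: if_splits)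
        show "cmod (f' u k - f' T k) \<le> 2 * C / x ^ tdeg k" if "u \<in> {0..T + 1}" for u
          using norm_triangle_ineq4[of "f' u k" "f' T k"] bound[of u k] bound[of T k] that T by simp
      qed (use T in auto)
      then have "cmod (?g t k - f' T k) \<le> 2 * C / x ^ tdeg k"
        using t unfolding g[OF conjunct1[OF t(2)]] by (simp add: divide_le_eq mult_ac)
      then show "cmod (?g t k) \<le> 3 * C / x ^ tdeg k"
        using norm_triangle_sub[of "?g t k" "f' T k"] bound[of T k] T by simp
    qed auto
    show "cmod (f' T k) \<le> 3 * C / x ^ tdeg k" for k
      using bound[of T k] T C x_pos by (intro order_trans[OF bound]) (auto intro!: divide_right_mono)
    show "((\<lambda>t. ?g t k) \<longlongrightarrow> f' T k) (at T within {0..})" for k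
    proof -
      have "((\<lambda>t. cmod (f t k - f T k - (t - T) *\<^sub>R f' T k) / \<bar>t - T\<bar>) \<longlongrightarrow> 0) (at T within {0..})"
        using deriv[OF T, of k] unfolding has_vector_derivative_def has_derivative_iff_norm by simp
      moreover have "\<forall>\<^sub>F t in at T within {0..}.
          cmod (f t k - f T k - (t - T) *\<^sub>R f' T k) / \<bar>t - T\<bar> = cmod (?g t k - f' T k)"
        unfolding eventually_at
        by (intro exI[of _ 1] conjI ballI impI g[symmetric]) auto
      ultimately have "((\<lambda>t. cmod (?g t k - f' T k)) \<longlongrightarrow> 0) (at T within {0..})"
        by (rule Lim_transform_eventually)
      then show ?thesis
        using Lim_null tendsto_norm_zero_iff by blast
    qed
  qed
  then show ?thesis unfolding has_norm_deriv_def eq .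
qed

end

text \<open>Summability at the single point with all coordinates \<open>\<rho> / 2\<close> is
  absolute, so each term there is bounded by the sum \<open>A\<close>.\<close>

lemma analytic_space_coeff_bound:
  assumes "in_kappa f \<in> analytic_space \<rho>" and "\<rho> > 0"
  obtains A where "\<And>k. cmod (f k) \<le> A / ((\<rho> / 2)\<^sup>2) ^ tdeg k"
proof -
  define p where "p = ((\<chi> j. of_real (\<rho> / 2)) :: complex^'a, (\<chi> j. of_real (\<rho> / 2)) :: complex^'a)"
  have "p \<in> polydisc \<rho>" using assms(2) by (simp add: p_def polydisc_def)
  then have "(\<lambda>k. in_kappa f k * monom_val p k) summable_on UNIV"
    using assms(1) by (simp add: analytic_space_def)
  then have abs: "(\<lambda>k. cmod (in_kappa f k * monom_val p k)) summable_on UNIV"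
    by (simp only: summable_on_iff_abs_summable_on_complex)
  define A where "A = (\<Sum>\<^sub>\<infinity>k. cmod (in_kappa f k * monom_val p k))"
  have "cmod (f k) \<le> A / ((\<rho> / 2)\<^sup>2) ^ tdeg k" for k
  proof -
    have v: "monom_val p (k, k) = of_real (((\<rho> / 2)\<^sup>2) ^ tdeg k)"
    proof -
      have "(\<Prod>j\<in>UNIV. c ^ (k $ j)) = c ^ tdeg k" for c :: complex
        by (simp add: tdeg_def power_sum)
      then have "monom_val p (k, k) = of_real (\<rho> / 2) ^ tdeg k * of_real (\<rho> / 2) ^ tdeg k"
        unfolding p_def monom_val_def by (simp only: prod.case vec_lambda_beta)
      then show ?thesis by (simp add: power2_eq_square flip: power_mult_distrib)
    qed
    have "cmod (in_kappa f (k, k) * monom_val p (k, k)) \<le> A"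
      using finite_sum_le_infsum[OF abs, of "{(k, k)}"] by (simp add: A_def)
    then have "cmod (f k) * ((\<rho> / 2)\<^sup>2) ^ tdeg k \<le> A"
      using assms(2) by (simp add: v in_kappa_def norm_mult norm_power)
    then show ?thesis using assms(2) by (simp add: pos_le_divide_eq)
  qed
  then show thesis by (rule that)
qed

subsection \<open>The solution of the original system\<close>

context normal_flow
begin

lemma wt_s_le:
  assumes "a \<ge> 0" shows "a * wt k / s t ^ m \<le> a / (s0 / 2) ^ m"
proof -
  have "a * wt k \<le> a * 1" using assms wt_le_1 by (intro mult_left_mono) auto
  then show ?thesis
    using assms s_gt[of t] s0_pos by (intro frac_le power_mono) auto
qed

lemma bound_s_of_s0:
  assumes "\<And>k. cmod (f k) \<le> A * wt k / s0 ^ tdeg k" and "t \<ge> 0"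
  shows "cmod (f k) \<le> A * wt k / s t ^ tdeg k"
proof -
  have "A \<ge> 0" using order_trans[OF norm_ge_zero assms(1)[of 0]] by simp
  then show ?thesis
    using s_le[OF assms(2)] s_pos[of t] wt_pos[of k]
    by (intro order_trans[OF assms(1)] divide_left_mono power_mono mult_pos_pos) auto
qed

text \<open>For \<open>f\<close> the initial value of \<open>N^q\<close> or \<open>N^-q\<close> this
  bounds the solution; growth at half the rate \<open>w\<close> is what makes it vanish after
  multiplication by \<open>exp (- w * t)\<close>.\<close>

lemma cauchy_flow_bound:
  assumes f: "\<And>k. cmod (f k) \<le> A * wt k / s0 ^ tdeg k" and t: "t \<ge> 0"
  shows "cmod (cauchy f (flow t) k) \<le> 8 ^ CARD('n) * A * exp (w / 2 * t) / (s0 / 2) ^ tdeg k"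
proof -
  have A: "A \<ge> 0" using order_trans[OF norm_ge_zero f[of 0]] by simp
  have "cmod (cauchy f (flow t) k) \<le> 8 ^ CARD('n) * A * exp (w / 2 * t) * wt k / s t ^ tdeg k"
    using bounded_flow_flow t unfolding bounded_flow_def
    by (intro cauchy_bound[OF s_pos bound_s_of_s0[OF f t]]) auto
  also have "\<dots> \<le> 8 ^ CARD('n) * A * exp (w / 2 * t) / (s0 / 2) ^ tdeg k"
    using A by (intro wt_s_le) auto
  finally show ?thesis .
qed

lemma cauchy_rate_E_bound:
  assumes f: "\<And>k. cmod (f k) \<le> A * wt k / s0 ^ tdeg k" and t: "0 \<le> t" "t \<le> T"
  shows "cmod (cauchy f (rate_E flow t) k)
    \<le> 8 ^ CARD('n) * A * (w / 8 * exp (w / 2 * T)) / (s0 / 2) ^ tdeg k"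
proof -
  have A: "A \<ge> 0" using order_trans[OF norm_ge_zero f[of 0]] by simp
  have "cmod (cauchy f (rate_E flow t) k)
      \<le> 8 ^ CARD('n) * A * (w / 8 * exp (w / 2 * t)) * wt k / s t ^ tdeg k"
    by (intro cauchy_bound s_pos bound_s_of_s0 f rate_E_bound regular_flow bounded_flow_flow t)
  also have "\<dots> \<le> 8 ^ CARD('n) * A * (w / 8 * exp (w / 2 * t)) / (s0 / 2) ^ tdeg k"
    using A w_pos by (intro wt_s_le) auto
  also have "\<dots> \<le> 8 ^ CARD('n) * A * (w / 8 * exp (w / 2 * T)) / (s0 / 2) ^ tdeg k"
    using A w_pos t s0_pos by (intro divide_right_mono mult_left_mono) auto
  finally show ?thesis .
qed

lemma cauchy_flow_deriv:
  "t \<ge> 0 \<Longrightarrow>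
    ((\<lambda>t. cauchy f (flow t) k) has_vector_derivative cauchy f (rate_E flow t) k) (at t within {0..})"
  by (intro has_vector_derivative_cauchy_left flow_deriv)

lemma N_of_flow_bound:
  assumes t: "t \<ge> 0"
  shows "cmod (N_of flow t k) \<le> \<alpha> / (s0 / 2) / (s0 / 2) ^ tdeg k"
proof -
  have "cmod (N_of flow t k) \<le> \<alpha> * wt1 k / s t ^ (tdeg k + 1)"
    by (intro N_of_bound regular_flow bounded_flow_flow t)
  also have "\<dots> \<le> \<alpha> * wt k / s t ^ (tdeg k + 1)"
    using s_pos[of t] \<alpha>_nonneg by (intro divide_right_mono mult_left_mono wt1_le_wt) auto
  also have "\<dots> \<le> \<alpha> / (s0 / 2) ^ (tdeg k + 1)"
    by (intro wt_s_le \<alpha>_nonneg)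
  finally show ?thesis by (simp add: mult.commute)
qed

lemma rate_N_flow_bound:
  assumes t: "t \<ge> 0"
  shows "cmod (rate_N flow t k) \<le> \<alpha> * (w / 8) / (s0 / 2) / (s0 / 2) ^ tdeg k * exp (- (w / 4) * t)"
proof -
  have "cmod (rate_N flow t k) \<le> \<alpha> * wt k * (w / 8 * exp (- (w / 4) * t)) / s t ^ (tdeg k + 1)"
    by (intro rate_N_bound bounded_flow_flow t)
  also have "\<dots> = \<alpha> * (w / 8 * exp (- (w / 4) * t)) * wt k / s t ^ (tdeg k + 1)" by simp
  also have "\<dots> \<le> \<alpha> * (w / 8 * exp (- (w / 4) * t)) / (s0 / 2) ^ (tdeg k + 1)"
    using w_pos \<alpha>_nonneg by (intro wt_s_le) auto
  finally show ?thesis by (simp add: mult_ac)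
qed

lemma polydisc_radius: "polydisc_radius (sqrt (s0 / 8)) (s0 / 2)"
  using s0_pos by unfold_locales auto

text \<open>Decay at rate \<open>w\<close> outweighs growth at rate \<open>w / 2\<close>. What
  remains gives both the uniform geometric bound and the coefficientwise limit 0.\<close>

lemma norm_limit_cauchy_flow:
  assumes f: "\<And>k. cmod (f k) \<le> A * wt k / s0 ^ tdeg k"
  shows "norm_limit (sqrt (s0 / 8)) (\<lambda>t k. of_real (exp (- w * t)) * in_kappa (cauchy f (flow t)) k) (\<lambda>k. 0) at_top"
proof -
  interpret polydisc_radius "sqrt (s0 / 8)" "s0 / 2" by (rule polydisc_radius)
  define C where "C = 8 ^ CARD('n) * A"
  have C: "C \<ge> 0" using order_trans[OF norm_ge_zero f[of 0]] by (simp add: C_def)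
  have b: "cmod (of_real (exp (- w * t)) * cauchy f (flow t) k) \<le> C / (s0 / 2) ^ tdeg k * exp (- (w / 2) * t)"
    if t: "t \<ge> 0" for t k
  proof -
    have e: "exp (- w * t) * exp (w / 2 * t) = exp (- (w / 2) * t)"
      by (simp flip: exp_add)
    have "cmod (of_real (exp (- w * t)) * cauchy f (flow t) k)
        \<le> exp (- w * t) * (8 ^ CARD('n) * A * exp (w / 2 * t) / (s0 / 2) ^ tdeg k)"
      unfolding norm_mult by (intro mult_mono cauchy_flow_bound f t) auto
    also have "\<dots> = C / (s0 / 2) ^ tdeg k * (exp (- w * t) * exp (w / 2 * t))"
      by (simp add: C_def)
    finally show ?thesis unfolding e .
  qed
  have "norm_limit (sqrt (s0 / 8)) (\<lambda>t. in_kappa (\<lambda>k. of_real (exp (- w * t)) * cauchy f (flow t) k)) (in_kappa (\<lambda>k. 0)) at_top"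
  proof (rule norm_limit_in_kappa[where C = C])
    have "cmod (of_real (exp (- w * t)) * cauchy f (flow t) k) \<le> C / (s0 / 2) ^ tdeg k"
      if t: "t \<ge> 0" for t k
    proof -
      have "C / (s0 / 2) ^ tdeg k * exp (- (w / 2) * t) \<le> C / (s0 / 2) ^ tdeg k * 1"
        using C s0_pos w_pos t by (intro mult_left_mono) auto
      then show ?thesis using b[OF t, of k] by simp
    qed
    then show "\<forall>\<^sub>F t in at_top. \<forall>k. cmod (of_real (exp (- w * t)) * cauchy f (flow t) k) \<le> C / (s0 / 2) ^ tdeg k"
      by (intro eventually_at_top_linorderI[of 0]) auto
    show "((\<lambda>t. of_real (exp (- w * t)) * cauchy f (flow t) k) \<longlongrightarrow> 0) at_top" for k
    proof (rule Lim_null_comparison)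
      show "\<forall>\<^sub>F t in at_top. cmod (of_real (exp (- w * t)) * cauchy f (flow t) k)
          \<le> C / (s0 / 2) ^ tdeg k * exp (- (w / 2) * t)"
        by (rule eventually_at_top_linorderI[OF b])
      have "((\<lambda>t. C / (s0 / 2) ^ tdeg k * exp (- (w / 2) * t)) \<longlongrightarrow> C / (s0 / 2) ^ tdeg k * 0) at_top"
        by (intro tendsto_mult_left filterlim_compose[OF exp_at_bot]
          filterlim_tendsto_neg_mult_at_bot[OF tendsto_const _ filterlim_ident]) (use w_pos in auto)
      then show "((\<lambda>t. C / (s0 / 2) ^ tdeg k * exp (- (w / 2) * t)) \<longlongrightarrow> 0) at_top" by simp
    qed
  qed (use C s0_pos in auto)
  moreover have "in_kappa (\<lambda>k. of_real (exp (- w * t)) * cauchy f (flow t) k)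
      = (\<lambda>k. of_real (exp (- w * t)) * in_kappa (cauchy f (flow t)) k)" for t
    by (auto simp: in_kappa_def)
  moreover have "in_kappa (\<lambda>k :: nat^'n. 0) = (\<lambda>k. 0)" by (auto simp: in_kappa_def)
  ultimately show ?thesis by simp
qed

text \<open>Each coefficient has an exponentially decaying derivative and hence a limit. The limits
  inherit the uniform bound of \<open>N_of flow\<close>, which upgrades the convergence to the
  norm.\<close>

lemma norm_limit_N_of_flow:
  "\<exists>L \<in> kappa_space \<inter> analytic_space (sqrt (s0 / 8)).
     norm_limit (sqrt (s0 / 8)) (\<lambda>t. in_kappa (N_of flow t)) L at_top"
proof -
  interpret polydisc_radius "sqrt (s0 / 8)" "s0 / 2" by (rule polydisc_radius)
  have "\<exists>l. ((\<lambda>t. N_of flow t k) \<longlongrightarrow> l) at_top" for k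
    by (rule convergent_of_exp_decaying_deriv[OF N_of_deriv[OF regular_flow] rate_N_flow_bound])
      (use w_pos in auto)
  then obtain l where l: "\<And>k. ((\<lambda>t. N_of flow t k) \<longlongrightarrow> l k) at_top" by metis
  have ev: "\<forall>\<^sub>F t in at_top. \<forall>k. cmod (N_of flow t k) \<le> \<alpha> / (s0 / 2) / (s0 / 2) ^ tdeg k"
    using N_of_flow_bound by (intro eventually_at_top_linorderI[of 0]) auto
  have lb: "cmod (l k) \<le> \<alpha> / (s0 / 2) / (s0 / 2) ^ tdeg k" for k
    by (rule tendsto_upperbound[OF tendsto_norm[OF l]]) (use ev in \<open>auto elim: eventually_mono\<close>)
  show ?thesis
    using norm_limit_in_kappa[OF ev lb l] in_analytic_space[OF lb] by (auto simp: kappa_space_def)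
qed

end

section \<open>Radii and constants for the initial values\<close>

lemma germ_bound:
  assumes "in_kappa f \<in> analytic_germs"
  obtains A y where "A \<ge> 0" "y > 0" "\<And>k. cmod (f k) \<le> A * wt1 k / y ^ tdeg k"
proof -
  obtain \<rho> where \<rho>: "\<rho> > 0" "in_kappa f \<in> analytic_space \<rho>"
    using assms by (auto simp: analytic_germs_def)
  obtain A where A: "\<And>k. cmod (f k) \<le> A / ((\<rho> / 2)\<^sup>2) ^ tdeg k"
    using analytic_space_coeff_bound[OF \<rho>(2,1)] by blast
  have A0: "A \<ge> 0" using order_trans[OF norm_ge_zero A[of 0]] by simp
  \<comment> \<open>By \<open>wt1_lower\<close> the weight is paid for by dividing the radius by
    8.\<close>
  have "cmod (f k) \<le> A * wt1 k / ((\<rho> / 2)\<^sup>2 / 8) ^ tdeg k" for k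
  proof -
    have "A * 1 / ((\<rho> / 2)\<^sup>2) ^ tdeg k \<le> A * (8 ^ tdeg k * wt1 k) / ((\<rho> / 2)\<^sup>2) ^ tdeg k"
      using A0 by (intro divide_right_mono mult_left_mono wt1_lower) auto
    then show ?thesis
      using A[of k] \<rho>(1) by (simp add: power_divide[of _ 8] mult_ac)
  qed
  then show thesis using that[OF A0, of "(\<rho> / 2)\<^sup>2 / 8"] \<rho>(1) by simp
qed

text \<open>In a series that starts in degree \<open>m\<close>, every term gains at least the
  \<open>m\<close>-th power of the ratio of the radii. With \<open>m = 0\<close> this moves bounds
  to a common radius and a common constant \<open>B\<close>.\<close>

lemma shrink_radius:
  assumes f: "\<And>k. cmod (f k) \<le> A * wt1 k / y ^ tdeg k" and low: "\<And>k. tdeg k < m \<Longrightarrow> f k = 0"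
    and r: "0 < r" "r \<le> y" and A: "0 \<le> A" "A \<le> B"
  shows "cmod (f k) \<le> B * (r / y) ^ m * wt1 k / r ^ tdeg k"
proof (cases "tdeg k < m")
  case True
  then show ?thesis using low[OF True] r A wt1_pos[of k] by simp
next
  case False
  have "cmod (f k) \<le> A * wt1 k / r ^ tdeg k * (r / y) ^ tdeg k"
    using f[of k] r by (simp add: power_divide)
  also have "\<dots> \<le> B * wt1 k / r ^ tdeg k * (r / y) ^ m"
    using False r A wt1_pos[of k]
    by (intro mult_mono divide_right_mono mult_right_mono power_decreasing) auto
  finally show ?thesis by (simp add: mult_ac)
qed

lemma monom_kappa_bound:
  assumes "y > 0"
  shows "cmod (monom_kappa m k) \<le> y ^ tdeg m / wt1 m * wt1 k / y ^ tdeg k"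
  using assms wt1_pos[of m] wt1_pos[of k] by (auto simp: monom_kappa_def)

lemma cauchy_uminus_right: "cauchy f (\<lambda>k. - g k) = (\<lambda>k. - cauchy f g k)"
  by (simp add: cauchy_def case_prod_unfold sum_negf fun_eq_iff)

lemma cauchy_left_commute: "cauchy f (cauchy g h) = cauchy g (cauchy f h)"
  by (metis cauchy_assoc cauchy_commute)

theorem theorem7:
  fixes \<omega> :: "real^'n::finite" and q :: "int^'n"
    and hNp hNm hN0 :: "'n series"
  assumes "nonresonant \<omega>"
    and "q \<noteq> 0" and "pairing \<omega> q > 0"
    and "hNp \<in> kappa_space \<inter> analytic_germs"
    and "hNm \<in> kappa_space \<inter> analytic_germs"
    and "hN0 \<in> kappa_space \<inter> analytic_germs"
    and "is_O_z 3 (monom_series (min_exponent q) \<star> hNp)"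
    and "is_O_z 3 (monom_series (min_exponent (- q)) \<star> hNm)"
    and "is_O_kappa 2 hN0"
  shows "\<exists>\<rho>>0. \<exists>Np Nm N0 :: real \<Rightarrow> 'n series.
      Np 0 = hNp \<and> Nm 0 = hNm \<and> N0 0 = hN0 \<and>
      (\<forall>\<delta>\<ge>0.
         Np \<delta> \<in> kappa_space \<inter> analytic_space \<rho> \<and>
         Nm \<delta> \<in> kappa_space \<inter> analytic_space \<rho> \<and>
         N0 \<delta> \<in> kappa_space \<inter> analytic_space \<rho> \<and>
         has_norm_deriv \<rho> Np (\<lambda>k. - (Np \<delta> \<star> dir_deriv_kappa q (N0 \<delta>)) k) \<delta> \<and>
         has_norm_deriv \<rho> Nm (\<lambda>k. - (Nm \<delta> \<star> dir_deriv_kappa q (N0 \<delta>)) k) \<delta> \<and>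
         has_norm_deriv \<rho> N0
           (\<lambda>k. - 2 * dir_deriv_kappa q (kappa_abs q \<star> Nm \<delta> \<star> Np \<delta>) k
                 * of_real (exp (- 2 * freq \<omega> q * \<delta>))) \<delta>) \<and>
      norm_limit \<rho> (\<lambda>\<delta> k. of_real (exp (- freq \<omega> q * \<delta>)) * Np \<delta> k) (\<lambda>k. 0) at_top \<and>
      norm_limit \<rho> (\<lambda>\<delta> k. of_real (exp (- freq \<omega> q * \<delta>)) * Nm \<delta> k) (\<lambda>k. 0) at_top \<and>
      (\<exists>L \<in> kappa_space \<inter> analytic_space \<rho>. norm_limit \<rho> N0 L at_top)"
proof -
  define w where "w = freq \<omega> q"
  have w: "w > 0" using assms(3) by (simp add: w_def freq_def)
  obtain fp fm f0 where fp: "hNp = in_kappa fp" and fm: "hNm = in_kappa fm" and f0: "hN0 = in_kappa f0"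
    using assms(4-6) by (auto simp: kappa_space_def)
  obtain Ap yp where Ap: "Ap \<ge> 0" "yp > 0" "\<And>k. cmod (fp k) \<le> Ap * wt1 k / yp ^ tdeg k"
    using germ_bound[of fp] assms(4) fp by auto
  obtain Am ym where Am: "Am \<ge> 0" "ym > 0" "\<And>k. cmod (fm k) \<le> Am * wt1 k / ym ^ tdeg k"
    using germ_bound[of fm] assms(5) fm by auto
  obtain A0 y0 where A0: "A0 \<ge> 0" "y0 > 0" "\<And>k. cmod (f0 k) \<le> A0 * wt1 k / y0 ^ tdeg k"
    using germ_bound[of f0] assms(6) f0 by auto
  define y where "y = min yp (min ym y0)"
  have y: "y > 0" "y \<le> yp" "y \<le> ym" "y \<le> y0" using Ap(2) Am(2) A0(2) by (auto simp: y_def)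
  define m :: "nat^'n" where "m = (\<chi> j. nat \<bar>q $ j\<bar>)"
  define K :: real where "K = 2 * 8 ^ CARD('n)"
  define G where "G = cauchy (monom_kappa m) (cauchy fm fp)"
  \<comment> \<open>One constant for all three initial values and for \<open>G\<close> at radius
    \<open>y\<close>; the last summand comes from two applications of
    \<open>cauchy_bound1\<close>.\<close>
  define A where "A = Ap + Am + A0 + K * (y ^ tdeg m / wt1 m) * (K * Am * Ap)"
  have K: "K > 0" by (simp add: K_def)
  have AG: "K * (y ^ tdeg m / wt1 m) * (K * Am * Ap) \<ge> 0"
    using Ap Am y K wt1_pos[of m] by (intro mult_nonneg_nonneg) auto
  then have A: "Ap \<le> A" "Am \<le> A" "A0 \<le> A" "K * (y ^ tdeg m / wt1 m) * (K * Am * Ap) \<le> A" "A \<ge> 0"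
    using Ap(1) Am(1) A0(1) by (auto simp: A_def)
  have "cmod (fp k) \<le> Ap * wt1 k / y ^ tdeg k" "cmod (fm k) \<le> Am * wt1 k / y ^ tdeg k" for k
    using shrink_radius[OF Ap(3), of 0 y Ap k] shrink_radius[OF Am(3), of 0 y Am k] y Ap Am by auto
  then have G_y: "cmod (G k) \<le> K * (y ^ tdeg m / wt1 m) * (K * Am * Ap) * wt1 k / y ^ tdeg k" for k
    unfolding G_def K_def using y(1) by (intro cauchy_bound1 monom_kappa_bound) auto
  have m': "tdeg (\<chi> j. nat \<bar>(- q) $ j\<bar>) = tdeg m" by (simp add: m_def)
  have low_p: "fp k = 0" if "tdeg m + 2 * tdeg k < 3" for k
    using low_degree_of_is_O_z assms(7) that unfolding fp m_def by blast
  have low_m: "fm k = 0" if "tdeg m + 2 * tdeg k < 3" for k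
    using low_degree_of_is_O_z[of "- q" fm k] assms(8) that unfolding fm m' by blast
  have G_low: "G k = 0" if "tdeg k < 3" for k
  proof -
    \<comment> \<open>\<open>e\<close> is the least \<open>d\<close> with \<open>|q| + 2 d \<ge> 3\<close>: both factors \<open>fm\<close>, \<open>fp\<close> start in degree \<open>e\<close>.\<close>
    define e where "e = (if tdeg m < 3 then (4 - tdeg m) div 2 else 0)"
    have e: "tdeg m + (e + e) \<ge> 3" "d < e \<Longrightarrow> tdeg m + 2 * d < 3" for d
      unfolding e_def by presburger+
    have "cauchy fm fp k = 0" if "tdeg k < e + e" for k
      by (rule cauchy_low_degree[OF _ _ that]) (auto intro!: low_p low_m e)
    then show ?thesis
      unfolding G_def
      by (rule cauchy_low_degree[where m = "tdeg m" and n = "e + e", rotated])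
        (use that e in \<open>auto simp: monom_kappa_def\<close>)
  qed
  have f0_low: "f0 k = 0" if "tdeg k < 2" for k
  proof -
    obtain g where g: "hN0 = in_kappa g" "\<And>k. tdeg k < 2 \<Longrightarrow> g k = 0"
      using assms(9) by (auto simp: is_O_kappa_def tdeg_def)
    have "f0 k = in_kappa g (k, k)" using f0 g(1) by (simp add: in_kappa_def fun_eq_iff)
    then show ?thesis using g(2)[OF that] by (simp add: in_kappa_def)
  qed
  define Q where "Q = (\<Sum>j\<in>UNIV. \<bar>real_of_int (q $ j)\<bar>)"
  have Q: "Q \<ge> 0" by (simp add: Q_def sum_nonneg)
  \<comment> \<open>The choice serves \<open>\<alpha> = \<Lambda> * s0 ^ 3\<close>. The first
    summand covers the bound on \<open>f0\<close>, whose order 2 yields \<open>s0 ^ 2\<close> while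
    the exponent \<open>tdeg k + 1\<close> asks for one more power; the second is
    \<open>\<alpha>_large\<close> solved for \<Lambda>.\<close>
  define \<Lambda> where "\<Lambda> = A / y\<^sup>2 + 16 * Q * K\<^sup>2 * A / (y ^ 3 * w)"
  have \<Lambda>: "\<Lambda> \<ge> 0" "A / y\<^sup>2 \<le> \<Lambda>" "16 * Q * K\<^sup>2 * A / (y ^ 3 * w) \<le> \<Lambda>"
    using A y w Q by (auto simp: \<Lambda>_def)
  \<comment> \<open>The second entry solves \<open>\<alpha>_small\<close>, in which
    \<open>\<alpha> / s0^2\<close> is \<open>\<Lambda> * s0\<close>; adding 1 keeps the denominator
    positive.\<close>
  define s0 where "s0 = min y (w / (32 * 8 ^ CARD('n) * (Q * \<Lambda> + 1)))"
  have Q\<Lambda>: "Q * \<Lambda> + 1 > 0" using Q \<Lambda>(1) by (simp add: add_nonneg_pos)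
  have s0: "s0 > 0" "s0 \<le> y" "s0 \<le> w / (32 * 8 ^ CARD('n) * (Q * \<Lambda> + 1))"
    using y w Q\<Lambda> by (auto simp: s0_def)
  define \<alpha> \<mu> where "\<alpha> = \<Lambda> * s0 ^ 3" and "\<mu> = A * (s0 / y) ^ 3"
  have "normal_flow q G f0 w s0 \<mu> \<alpha>"
  proof (unfold_locales, fold Q_def)
    show "cmod (G k) \<le> \<mu> * wt1 k / s0 ^ tdeg k" for k
      using shrink_radius[OF G_y G_low] s0 AG A unfolding \<mu>_def by blast
    show "cmod (f0 k) \<le> \<alpha> * wt1 k / s0 ^ (tdeg k + 1)" for k
    proof -
      have "cmod (f0 k) \<le> A * (s0 / y0)\<^sup>2 * wt1 k / s0 ^ tdeg k"
        using shrink_radius[OF A0(3) f0_low] s0 y A0 A by auto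
      also have "\<dots> \<le> A * (s0 / y)\<^sup>2 * wt1 k / s0 ^ tdeg k"
        using s0 y A wt1_pos[of k]
        by (intro divide_right_mono mult_right_mono mult_left_mono power_mono divide_left_mono) auto
      also have "\<dots> = A / y\<^sup>2 * (s0 ^ 3 * wt1 k / s0 ^ (tdeg k + 1))"
        using s0 by (simp add: power2_eq_square power3_eq_cube)
      also have "\<dots> \<le> \<Lambda> * (s0 ^ 3 * wt1 k / s0 ^ (tdeg k + 1))"
        using s0 wt1_pos[of k] by (intro mult_right_mono \<Lambda>) auto
      finally show ?thesis by (simp add: \<alpha>_def)
    qed
    have "16 * Q * K\<^sup>2 * A / (y ^ 3 * w) * (s0 ^ 3 * w / 8) \<le> \<Lambda> * (s0 ^ 3 * w / 8)"
      using s0 w by (intro mult_right_mono \<Lambda>) auto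
    moreover have "16 * Q * K\<^sup>2 * A / (y ^ 3 * w) * (s0 ^ 3 * w / 8) = 2 * (Q * (K\<^sup>2 * \<mu>))"
      using w y by (simp add: \<mu>_def power_divide)
    ultimately show "2 * (Q * ((2 * 8 ^ CARD('n))\<^sup>2 * \<mu>)) \<le> \<alpha> * w / 8"
      unfolding K_def \<alpha>_def by simp
    have "32 * 8 ^ CARD('n) * (Q * \<Lambda>) * s0 \<le> 32 * 8 ^ CARD('n) * (Q * \<Lambda> + 1) * s0"
      using s0 by (intro mult_right_mono mult_left_mono) auto
    also have "\<dots> \<le> w"
      using s0(3) Q\<Lambda> by (simp add: pos_le_divide_eq mult.commute)
    finally have "32 * 8 ^ CARD('n) * (Q * \<Lambda>) * s0 \<le> w" .
    then show "8 ^ CARD('n) * (4 * Q * \<alpha> / s0\<^sup>2) \<le> w / 8"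
      using s0 by (simp add: \<alpha>_def power2_eq_square power3_eq_cube mult_ac)
  qed (use w s0 G_low f0_low in auto)
  then interpret normal_flow q G f0 w s0 \<mu> \<alpha> Q
    by (simp_all add: Q_def)
  define \<rho> where "\<rho> = sqrt (s0 / 8)"
  interpret polydisc_radius \<rho> "s0 / 2" unfolding \<rho>_def by (rule polydisc_radius)
  have bound: "cmod (f k) \<le> A * wt k / s0 ^ tdeg k"
    if "\<And>k. cmod (f k) \<le> B * wt1 k / z ^ tdeg k" "B \<ge> 0" "B \<le> A" "y \<le> z" for f B z k
  proof -
    have "cmod (f k) \<le> A * wt1 k / s0 ^ tdeg k"
      using shrink_radius[OF that(1), of 0 s0 A k] that s0 by auto
    also have "\<dots> \<le> A * wt k / s0 ^ tdeg k"
      using A s0 by (intro divide_right_mono mult_left_mono wt1_le_wt) auto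
    finally show ?thesis .
  qed
  have fp_b: "cmod (fp k) \<le> A * wt k / s0 ^ tdeg k" and fm_b: "cmod (fm k) \<le> A * wt k / s0 ^ tdeg k" for k
    using bound[OF Ap(3)] bound[OF Am(3)] Ap Am A y by auto
  define Np Nm N0 where "Np t = in_kappa (cauchy fp (flow t))" and "Nm t = in_kappa (cauchy fm (flow t))"
    and "N0 t = in_kappa (N_of flow t)" for t
  \<comment> \<open>By associativity \<open>f\<close> is pulled out of the linear equation, so the
    equation for \<open>E\<close> yields those for \<open>N^q\<close> and \<open>N^-q\<close> at
    once.\<close>
  have deriv: "has_norm_deriv \<rho> (\<lambda>t. in_kappa (cauchy f (flow t)))
      (\<lambda>k. - (in_kappa (cauchy f (flow t)) \<star> dir_deriv_kappa q (N0 t)) k) t"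
    if "\<And>k. cmod (f k) \<le> A * wt k / s0 ^ tdeg k" "t \<ge> 0" for f t
  proof -
    have "rate_E flow t = (\<lambda>k. - cauchy (flow t) (dir_deriv q (N_of flow t)) k)"
      by (simp add: rate_E_def fun_eq_iff)
    then have "(\<lambda>k. - (in_kappa (cauchy f (flow t)) \<star> dir_deriv_kappa q (N0 t)) k)
        = in_kappa (cauchy f (rate_E flow t))"
      by (simp add: N0_def dir_deriv_kappa_eq series_mult_in_kappa cauchy_assoc cauchy_uminus_right)
        (auto simp: in_kappa_def)
    moreover have "has_norm_deriv \<rho> (\<lambda>t. in_kappa (cauchy f (flow t))) (in_kappa (cauchy f (rate_E flow t))) t"
      using cauchy_flow_deriv cauchy_rate_E_bound[OF that(1)] that(2) by (rule has_norm_deriv_in_kappa)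
    ultimately show ?thesis by simp
  qed
  have deriv0: "has_norm_deriv \<rho> N0 (\<lambda>k. - 2 * dir_deriv_kappa q (kappa_abs q \<star> Nm t \<star> Np t) k
      * of_real (exp (- 2 * freq \<omega> q * t))) t" if t: "t \<ge> 0" for t
  proof -
    \<comment> \<open>Commutativity collects the two copies of \<open>flow t\<close> and leaves the
      initial product \<open>G\<close>.\<close>
    have *: "kappa_abs q \<star> Nm t \<star> Np t = in_kappa (cauchy G (cauchy (flow t) (flow t)))"
      unfolding kappa_abs_eq Nm_def Np_def series_mult_in_kappa G_def m_def
      by (simp only: cauchy_assoc cauchy_commute cauchy_left_commute)
    have "(\<lambda>k. - 2 * dir_deriv_kappa q (kappa_abs q \<star> Nm t \<star> Np t) k * of_real (exp (- 2 * freq \<omega> q * t)))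
        = in_kappa (rate_N flow t)"
      unfolding * dir_deriv_kappa_eq w_def[symmetric] by (auto simp: in_kappa_def rate_N_def)
    moreover have "has_norm_deriv \<rho> (\<lambda>t. in_kappa (N_of flow t)) (in_kappa (rate_N flow t)) t"
    proof (rule has_norm_deriv_in_kappa[OF N_of_deriv[OF regular_flow] _ t])
      fix t :: real and k :: "nat^'n" assume t: "0 \<le> t"
      have "\<alpha> * (w / 8) / (s0 / 2) / (s0 / 2) ^ tdeg k * exp (- (w / 4) * t)
          \<le> \<alpha> * (w / 8) / (s0 / 2) / (s0 / 2) ^ tdeg k * 1"
        using \<alpha>_nonneg w s0 t by (intro mult_left_mono) auto
      then show "cmod (rate_N flow t k) \<le> \<alpha> * (w / 8) / (s0 / 2) / (s0 / 2) ^ tdeg k"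
        using rate_N_flow_bound[OF t, of k] by simp
    qed
    ultimately show ?thesis by (simp add: N0_def[abs_def])
  qed
  show ?thesis
  proof (rule exI[of _ \<rho>], rule conjI[OF \<rho>_pos], rule exI[of _ Np], rule exI[of _ Nm],
      rule exI[of _ N0], intro conjI allI impI)
    show "Np 0 = hNp" "Nm 0 = hNm" "N0 0 = hN0"
      by (simp_all add: Np_def Nm_def N0_def fp fm f0 flow_0 cauchy_unit N_of_0)
    fix t :: real assume t: "t \<ge> 0"
    show "Np t \<in> kappa_space \<inter> analytic_space \<rho>" "Nm t \<in> kappa_space \<inter> analytic_space \<rho>"
        "N0 t \<in> kappa_space \<inter> analytic_space \<rho>"
      using in_analytic_space[OF cauchy_flow_bound[OF fp_b t]] in_analytic_space[OF cauchy_flow_bound[OF fm_b t]]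
        in_analytic_space[OF N_of_flow_bound[OF t]]
      by (auto simp: Np_def Nm_def N0_def kappa_space_def)
    show "has_norm_deriv \<rho> Np (\<lambda>k. - (Np t \<star> dir_deriv_kappa q (N0 t)) k) t"
      using deriv[OF fp_b t] by (simp add: Np_def[abs_def])
    show "has_norm_deriv \<rho> Nm (\<lambda>k. - (Nm t \<star> dir_deriv_kappa q (N0 t)) k) t"
      using deriv[OF fm_b t] by (simp add: Nm_def[abs_def])
    show "has_norm_deriv \<rho> N0 (\<lambda>k. - 2 * dir_deriv_kappa q (kappa_abs q \<star> Nm t \<star> Np t) k
        * of_real (exp (- 2 * freq \<omega> q * t))) t"
      by (rule deriv0[OF t])
  next
    show "norm_limit \<rho> (\<lambda>t k. of_real (exp (- freq \<omega> q * t)) * Np t k) (\<lambda>k. 0) at_top"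
      using norm_limit_cauchy_flow[OF fp_b] by (simp add: \<rho>_def Np_def w_def)
    show "norm_limit \<rho> (\<lambda>t k. of_real (exp (- freq \<omega> q * t)) * Nm t k) (\<lambda>k. 0) at_top"
      using norm_limit_cauchy_flow[OF fm_b] by (simp add: \<rho>_def Nm_def w_def)
    show "\<exists>L \<in> kappa_space \<inter> analytic_space \<rho>. norm_limit \<rho> N0 L at_top"
      using norm_limit_N_of_flow by (simp add: \<rho>_def N0_def[abs_def])
  qed
qed

end
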